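(* If an $s$-stage (collocation) GEPTRKN method is based on distinct collocation parameters $(c_i)_{i=1}^s$ satisfying $$\int_0^1\int_0^{1+t}\prod_{i=1}^s(\xi-c_i)\,d\xi\,dt=0,\qquad \int_0^1\xi^k\prod_{i=1}^s(\xi-c_i)\,d\xi=0,\quad k=0,1,$$ then the method has step order $p=s+2$.
   Context: Problem: $y''(t)=f(t,y(t),y'(t))$, $y(t_0)=y_0$, $y'(t_0)=y_0'$, $t\in[t_0,t_0+T]$ (written in scalar form), where $f:[t_0,t_0+T]\times\mathbb{R}\times\mathbb{R}\to\mathbb{R}$, $f(t,y,z)$, is continuous in $t$ and satisfies a Lipschitz condition in $y$ and $z$; $f$ and the exact solution $y$ are taken to be sufficiently smooth. Notation: $\bm{c}=(c_1,\dots,c_s)^T$, $\bm{e}=(1,\dots,1)^T\in\mathbb{R}^s$; powers of vectors are componentwise (zeroth power equal to $\bm{e}$), and scalar functions are applied to vectors componentwise, e.g. $f(\bm{e}t+\bm{c}h,\bm{Y},\bm{Y}')=(f(t+c_ih,Y_i,Y_i'))_{i=1}^s$. GEPTRKN (generalized explicit pseudo two-step Runge-Kutta-Nyström) method: with step-size $h$ and $t_{n+1}=t_n+h$, given $y_n\approx y(t_n)$, $y_n'\approx y'(t_n)$, $\bm{Y}_n\approx y(\bm{e}t_n+\bm{c}h)$, $\bm{Y}_n'\approx y'(\bm{e}t_n+\bm{c}h)$, put $F_n=f(\bm{e}t_n+\bm{c}h,\bm{Y}_n,\bm{Y}_n')$ and $$y_{n+1}=y_n+hy_n'+h^2\bm{b}^TF_n,\quad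 y'_{n+1}=y'_n+h\bm{d}^TF_n,$$ $$\bm{Y}_{n+1}=\bm{e}y_{n+1}+h\bm{c}y'_{n+1}+h^2\bm{A}F_n,\quad \bm{Y}'_{n+1}=\bm{e}y'_{n+1}+h\bm{B}F_n.$$ The initial stage vectors $\bm{Y}_0$ and $\bm{Y}'_0$ are assumed to be available at high accuracy. The method is a collocation method: $\bm{b},\bm{d}\in\mathbb{R}^s$ and $\bm{A},\bm{B}\in\mathbb{R}^{s\times s}$ are the coefficients uniquely determined by the following conditions for $k=0,\dots,s-1$: $$1=(k+2)(k+1)\bm{b}^T\bm{c}^k,\quad 1=(k+1)\bm{d}^T\bm{c}^k,\quad \bm{c}^{k+2}=(k+2)(k+1)\bm{A}(\bm{c}-\bm{e})^k,\quad \bm{c}^{k+1}=(k+1)\bm{B}(\bm{c}-\bm{e})^k.$$ Order: a GEPTRKN method is said to have step order $p=\min\{p_1,p_2\}$ and stage order $r=\min\{p_1,p_2,p_3,p_4\}$ if $$y(t_{n+1})-y_{n+1}=O(h^{p_1+1}),\quad y'(t_{n+1})-y'_{n+1}=O(h^{p_2+1}),$$ $$y(\bm{e}t_{n+1}+\bm{c}h)-\bm{Y}_{n+1}=O(h^{p_3+1}),\quad y'(\bm{e}t_{n+1}+\bm{c}h)-\bm{Y}'_{n+1}=O(h^{p_4+1}),$$ given that $y_n=y(t_n)+O(h^{p_1+1})$, $y'_n=y'(t_n)+O(h^{p_2+1})$, $y(\bm{e}t_n+\bm{c}h)-\bm{Y}_n=O(h^{p_3+1})$, and $y'(\bm{e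}t_n+\bm{c}h)-\bm{Y}'_n=O(h^{p_4+1})$.
   Formalization: In the definition of order, the stage vectors Y_n, Y_n' are also required to be starting vectors accurate to O(h^p) or computed by the method's preceding step; with arbitrary Y_n' errors of size O(h^(p4+1)) the claim fails, e.g. for f(t,y,z)=z. *)

theory Defs
  imports "HOL-Analysis.Analysis"
begin

(* k times continuously differentiable on S (via Frechet derivatives within S).  Used for
   S = {t0..t0+T} and S = {t0..t0+T} \<times> UNIV with T > 0, where derivatives within S are unique. *)
primrec Ck_on ::
  "nat \<Rightarrow> ('a::real_normed_vector \<Rightarrow> 'b::real_normed_vector) \<Rightarrow> 'a set \<Rightarrow> bool" where
  "Ck_on 0 = (\<lambda>f S. continuous_on S f)"
| "Ck_on (Suc k) = (\<lambda>f S. \<exists>f'. (\<forall>x\<in>S. (f has_derivative f' x) (at x within S)) \<and>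
                                  (\<forall>v. Ck_on k (\<lambda>x. f' x v) S))"

definition smooth_ivp_solution ::
  "nat \<Rightarrow> (real \<Rightarrow> real \<Rightarrow> real \<Rightarrow> real) \<Rightarrow> real \<Rightarrow> real \<Rightarrow> real \<Rightarrow> real \<Rightarrow>
   (real \<Rightarrow> real) \<Rightarrow> (real \<Rightarrow> real) \<Rightarrow> bool" where
  "smooth_ivp_solution q f t0 T y0 dy0 y dy \<longleftrightarrow>
     0 < T \<and>
     (\<forall>u v. continuous_on {t0..t0+T} (\<lambda>t. f t u v)) \<and>
     (\<exists>L. \<forall>t\<in>{t0..t0+T}. L-lipschitz_on UNIV (\<lambda>(u, v). f t u v)) \<and>
     Ck_on q (\<lambda>(t, u, v). f t u v) ({t0..t0+T} \<times> UNIV) \<and>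
     Ck_on q y {t0..t0+T} \<and>
     (\<forall>t\<in>{t0..t0+T}. (y has_real_derivative dy t) (at t within {t0..t0+T})) \<and>
     (\<forall>t\<in>{t0..t0+T}. (dy has_real_derivative f t (y t) (dy t)) (at t within {t0..t0+T})) \<and>
     y t0 = y0 \<and> dy t0 = dy0"

definition vpow :: "real^'s \<Rightarrow> nat \<Rightarrow> real^'s" where
  "vpow x k = (\<chi> i. (x $ i) ^ k)"

(* The vector of ones is the numeral 1 of the type real^'s. *)
definition collocation_coeffs ::
  "real^'s \<Rightarrow> real^'s \<Rightarrow> real^'s \<Rightarrow> real^'s^'s \<Rightarrow> real^'s^'s \<Rightarrow> bool" where
  "collocation_coeffs c b d A B \<longleftrightarrow>
     (\<forall>k<CARD('s).
        1 = (real k + 2) * (real k + 1) * (b \<bullet> vpow c k) \<and>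
        1 = (real k + 1) * (d \<bullet> vpow c k) \<and>
        vpow c (k + 2) = ((real k + 2) * (real k + 1)) *\<^sub>R (A *v vpow (c - 1) k) \<and>
        vpow c (k + 1) = (real k + 1) *\<^sub>R (B *v vpow (c - 1) k))"

definition stage_rhs ::
  "(real \<Rightarrow> real \<Rightarrow> real \<Rightarrow> real) \<Rightarrow> real^'s \<Rightarrow> real \<Rightarrow> real \<Rightarrow> real^'s \<Rightarrow> real^'s \<Rightarrow> real^'s" where
  "stage_rhs f c h t Y dY = (\<chi> i. f (t + c $ i * h) (Y $ i) (dY $ i))"

(* The four update formulas; F is the vector stage_rhs of the step being left.  In the two stage
   formulas u and du are the already updated values at the new grid point. *)
definition new_val :: "real^'s \<Rightarrow> real \<Rightarrow> real \<Rightarrow> real \<Rightarrow> real^'s \<Rightarrow> real" where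
  "new_val b h u du F = u + h * du + h\<^sup>2 * (b \<bullet> F)"

definition new_deriv :: "real^'s \<Rightarrow> real \<Rightarrow> real \<Rightarrow> real^'s \<Rightarrow> real" where
  "new_deriv d h du F = du + h * (d \<bullet> F)"

definition new_stage ::
  "real^'s \<Rightarrow> real^'s^'s \<Rightarrow> real \<Rightarrow> real \<Rightarrow> real \<Rightarrow> real^'s \<Rightarrow> real^'s" where
  "new_stage c A h u du F = u *\<^sub>R 1 + (h * du) *\<^sub>R c + h\<^sup>2 *\<^sub>R (A *v F)"

definition new_dstage :: "real^'s^'s \<Rightarrow> real \<Rightarrow> real \<Rightarrow> real^'s \<Rightarrow> real^'s" where
  "new_dstage B h du F = du *\<^sub>R 1 + h *\<^sub>R (B *v F)"

definition val_acc ::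
  "nat \<Rightarrow> (real \<Rightarrow> real) \<Rightarrow> (real \<Rightarrow> real) \<Rightarrow> (real \<Rightarrow> real) \<Rightarrow> bool" where
  "val_acc m y t u \<longleftrightarrow> (\<lambda>h. y (t h) - u h) \<in> O[at_right 0](\<lambda>h. h ^ m)"

definition stage_acc ::
  "nat \<Rightarrow> real^'s \<Rightarrow> (real \<Rightarrow> real) \<Rightarrow> (real \<Rightarrow> real) \<Rightarrow> (real \<Rightarrow> real^'s) \<Rightarrow> bool" where
  "stage_acc m c y t Y \<longleftrightarrow>
     (\<forall>i. (\<lambda>h. y (t h + c $ i * h) - Y h $ i) \<in> O[at_right 0](\<lambda>h. h ^ m))"

definition stage_grid_in :: "real set \<Rightarrow> real^'s \<Rightarrow> real \<Rightarrow> real \<Rightarrow> bool" where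
  "stage_grid_in J c h t \<longleftrightarrow> t \<in> J \<and> (\<forall>i. t + c $ i * h \<in> J)"

(* Where the stage vectors Y, dY used at the grid point t come from: they are starting vectors,
   accurate to O(h^p), or the method computed them in the preceding step, from stage vectors X, dX
   at t - h of accuracy O(h^(p3+1)), O(h^(p4+1)).  Arbitrary perturbations of size O(h^(p4+1)) of dY
   itself must not be admitted in the definition of order: they enter the new derivative value with
   a factor h only, whereas d can annihilate the leading error term of computed stage vectors. *)
definition method_stages ::
  "nat \<Rightarrow> nat \<Rightarrow> nat \<Rightarrow> real^'s \<Rightarrow> real^'s^'s \<Rightarrow> real^'s^'s \<Rightarrow>
   (real \<Rightarrow> real \<Rightarrow> real \<Rightarrow> real) \<Rightarrow> real set \<Rightarrow> (real \<Rightarrow> real) \<Rightarrow> (real \<Rightarrow> real) \<Rightarrow> (real \<Rightarrow> real) \<Rightarrow>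
   (real \<Rightarrow> real) \<Rightarrow> (real \<Rightarrow> real) \<Rightarrow> (real \<Rightarrow> real^'s) \<Rightarrow> (real \<Rightarrow> real^'s) \<Rightarrow> bool" where
  "method_stages p p3 p4 c A B f J y dy t u du Y dY \<longleftrightarrow>
     (stage_acc p c y t Y \<and> stage_acc p c dy t dY) \<or>
     (\<exists>X dX.
        (\<forall>\<^sub>F h in at_right 0. stage_grid_in J c h (t h - h)) \<and>
        stage_acc (p3 + 1) c y (\<lambda>h. t h - h) X \<and>
        stage_acc (p4 + 1) c dy (\<lambda>h. t h - h) dX \<and>
        (\<forall>\<^sub>F h in at_right 0.
           Y h = new_stage c A h (u h) (du h) (stage_rhs f c h (t h - h) (X h) (dX h)) \<and>
           dY h = new_dstage B h (du h) (stage_rhs f c h (t h - h) (X h) (dX h))))"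

(* All quantities of a step are functions of the step size h; in particular the grid point t = t_n
   is, since n may depend on h.  "Sufficiently smooth" is read as: of class C^q for some q that
   depends on the method only. *)
definition has_orders ::
  "real^'s \<Rightarrow> real^'s \<Rightarrow> real^'s \<Rightarrow> real^'s^'s \<Rightarrow> real^'s^'s \<Rightarrow> nat \<Rightarrow> nat \<Rightarrow> nat \<Rightarrow> nat \<Rightarrow> bool" where
  "has_orders c b d A B p1 p2 p3 p4 \<longleftrightarrow>
     (\<exists>q. \<forall>f t0 T y0 dy0 y dy. smooth_ivp_solution q f t0 T y0 dy0 y dy \<longrightarrow>
       (\<forall>t u du Y dY.
          (\<forall>\<^sub>F h in at_right 0. stage_grid_in {t0..t0+T} c h (t h)) \<longrightarrow>
          (\<forall>\<^sub>F h in at_right 0. stage_grid_in {t0..t0+T} c h (t h + h)) \<longrightarrow>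
          method_stages (min p1 p2) p3 p4 c A B f {t0..t0+T} y dy t u du Y dY \<longrightarrow>
          val_acc (p1 + 1) y t u \<longrightarrow>
          val_acc (p2 + 1) dy t du \<longrightarrow>
          stage_acc (p3 + 1) c y t Y \<longrightarrow>
          stage_acc (p4 + 1) c dy t dY \<longrightarrow>
          (let F = (\<lambda>h. stage_rhs f c h (t h) (Y h) (dY h));
               u1 = (\<lambda>h. new_val b h (u h) (du h) (F h));
               du1 = (\<lambda>h. new_deriv d h (du h) (F h));
               Y1 = (\<lambda>h. new_stage c A h (u1 h) (du1 h) (F h));
               dY1 = (\<lambda>h. new_dstage B h (du1 h) (F h));
               t1 = (\<lambda>h. t h + h)
           in val_acc (p1 + 1) y t1 u1 \<and>
              val_acc (p2 + 1) dy t1 du1 \<and>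
              stage_acc (p3 + 1) c y t1 Y1 \<and>
              stage_acc (p4 + 1) c dy t1 dY1)))"

definition has_step_order ::
  "real^'s \<Rightarrow> real^'s \<Rightarrow> real^'s \<Rightarrow> real^'s^'s \<Rightarrow> real^'s^'s \<Rightarrow> nat \<Rightarrow> bool" where
  "has_step_order c b d A B p \<longleftrightarrow>
     (\<exists>p1 p2 p3 p4. has_orders c b d A B p1 p2 p3 p4 \<and> p = min p1 p2)"

end

theory Submission
  imports Defs
begin

text \<open>With \<open>s\<close> stages the method has the orders \<open>p1 = p2 = s + 2\<close>, \<open>p3 = s + 1\<close> and \<open>p4 = s\<close>. Let
\<open>M(\<xi>)\<close> be the product of the factors \<open>\<xi> - c\<^sub>i\<close>.

The defining conditions make the weights \<open>b\<close> and \<open>d\<close> interpolatory for the integrals of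
\<open>(1 - \<xi>) p(\<xi>)\<close> and \<open>p(\<xi>)\<close> over \<open>[0, 1]\<close>. As for Gauss quadrature, division by \<open>M\<close> turns each
power of \<open>\<xi>\<close> that is orthogonal to \<open>M\<close>, with the respective weight function, into one further
degree of exactness. Orthogonality to \<open>1\<close> and \<open>\<xi>\<close>, hence to \<open>1 - \<xi>\<close>, makes
\<open>d\<close> exact up to degree \<open>s + 1\<close> and \<open>b\<close> up to degree \<open>s\<close>
(\<open>derivative_weights_exact\<close>, \<open>value_weights_exact\<close>), and Taylor expansion along the exact solution
gives both quadrature formulas of the step a local error of \<open>O(h^(s+3))\<close>. The stage formulas
have just the accuracy of collocation, \<open>O(h^(s+2))\<close> for the values and \<open>O(h^(s+1))\<close> for the
derivatives (\<open>collocation_defect\<close>).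

It remains to bound how the errors of the stages already present enter. In \<open>y\<close> they carry a
factor \<open>h^2\<close>, which suffices. In \<open>y'\<close> they carry only a factor \<open>h\<close>, so that the errors of size
\<open>h^(s+1)\<close> in the stage derivatives must cancel against each other. If these stages were
computed by the preceding step, their errors are \<open>K E\<^sub>i + O(h^(s+2))\<close>, where \<open>K = O(h^(s+1))\<close> is
the same for all stages and the vector \<open>E\<close> depends on the method only; up to higher order the
right-hand side multiplies them by one common number, its partial derivative with respect to
\<open>y'\<close> at the grid point. So the sum weighted by \<open>d\<close> is governed by \<open>d \<bullet> E\<close>. Since \<open>B\<close> is the
interpolatory formula at the nodes \<open>c\<^sub>j - 1\<close>, the number \<open>E\<^sub>i\<close> is the integral of \<open>M\<close> from \<open>1\<close> to
\<open>1 + c\<^sub>i\<close>, and because \<open>d\<close> is exact to degree \<open>s + 1\<close>, the product \<open>d \<bullet> E\<close> is the integral over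
\<open>t\<close> in \<open>[0, 1]\<close> of the integral of \<open>M\<close> from \<open>1\<close> to \<open>1 + t\<close>. It vanishes by the condition on the
double integral and the orthogonality of \<open>M\<close> to \<open>1\<close>
(\<open>derivative_weights_annihilate_stage_defect\<close>, \<open>weighted_rhs_error\<close>).\<close>

section \<open>Antiderivatives and interpolatory quadrature\<close>

text \<open>The antiderivative vanishing at \<open>0\<close>. Its values replace integrals from \<open>0\<close> to \<open>c\<^sub>i\<close>, which would
have to be oriented because the nodes may be negative.\<close>

definition antideriv :: "real poly \<Rightarrow> real poly" where
  "antideriv p = (\<Sum>k\<le>degree p. monom (coeff p k / real (Suc k)) (Suc k))"

lemma coeff_antideriv:
  "coeff (antideriv p) n = (case n of 0 \<Rightarrow> 0 | Suc k \<Rightarrow> coeff p k / real (Suc k))"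
proof (cases n)
  case (Suc m)
  have "coeff (antideriv p) n = (\<Sum>k\<le>degree p. if k = m then coeff p k / real (Suc k) else 0)"
    unfolding antideriv_def coeff_sum coeff_monom Suc by (intro sum.cong) auto
  also have "\<dots> = coeff p m / real (Suc m)"
    using coeff_eq_0[of p m] by (auto simp: not_le)
  finally show ?thesis using Suc by simp
qed (simp add: antideriv_def coeff_sum coeff_monom)

lemma antideriv_add: "antideriv (p + q) = antideriv p + antideriv q"
  by (rule poly_eqI) (simp add: coeff_antideriv add_divide_distrib split: nat.split)

lemma antideriv_smult: "antideriv (smult a p) = smult a (antideriv p)"
  by (rule poly_eqI) (simp add: coeff_antideriv split: nat.split)

lemma antideriv_monom: "antideriv (monom a k) = monom (a / real (Suc k)) (Suc k)"
  by (rule poly_eqI) (simp add: coeff_antideriv split: nat.split)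

lemma pderiv_antideriv: "pderiv (antideriv p) = p"
  by (rule poly_eqI) (simp add: coeff_pderiv coeff_antideriv)

lemma poly_antideriv_0: "poly (antideriv p) 0 = 0"
  by (simp add: poly_0_coeff_0 coeff_antideriv)

lemma antideriv_pderiv: "antideriv (pderiv p) = p - [:poly p 0:]"
  by (rule poly_eqI) (simp add: coeff_pderiv coeff_antideriv poly_0_coeff_0 split: nat.split)

lemma degree_antideriv: "degree (antideriv p) \<le> Suc (degree p)"
  by (rule degree_le) (auto simp: coeff_antideriv coeff_eq_0 split: nat.split)

text \<open>Cauchy's formula for repeated integration: at the point \<open>1\<close> it identifies the double
antiderivative with the integral of \<open>(1 - \<xi>) p(\<xi>)\<close>, the functional that \<open>b\<close> approximates.\<close>

lemma antideriv_antideriv: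
  "antideriv (antideriv p) = pCons 0 (antideriv p) - antideriv (pCons 0 p)"
proof (rule poly_eqI)
  have "x / (real k + 1) / (real k + 2) = x / (real k + 1) - x / (real k + 2)" for x k
    by (simp add: field_simps)
  then show "coeff (antideriv (antideriv p)) n
      = coeff (pCons 0 (antideriv p) - antideriv (pCons 0 p)) n" for n
    by (simp add: coeff_antideriv coeff_pCons add.commute split: nat.split)
qed

lemma integral_poly:
  fixes p :: "real poly"
  assumes "a \<le> b"
  shows "integral {a..b} (poly p) = poly (antideriv p) b - poly (antideriv p) a"
proof (rule integral_unique, rule fundamental_theorem_of_calculus[OF assms])
  fix x
  have "(poly (antideriv p) has_field_derivative poly p x) (at x within {a..b})"
    using poly_DERIV[of "antideriv p" x] unfolding pderiv_antideriv
    by (rule has_field_derivative_at_within)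
  then show "(poly (antideriv p) has_vector_derivative poly p x) (at x within {a..b})"
    by (simp add: has_real_derivative_iff_has_vector_derivative)
qed

lemma poly_functional_eq_0:
  fixes K :: "real poly \<Rightarrow> real"
  assumes add: "\<And>p q. K (p + q) = K p + K q" and smult: "\<And>a p. K (smult a p) = a * K p"
    and basis: "\<And>k. k < n \<Longrightarrow> K (monom 1 k) = 0"
    and deg: "degree p < n"
  shows "K p = 0"
proof -
  have K0: "K 0 = 0" using smult[of 0 0] by simp
  have Ksum: "K (sum g I) = (\<Sum>k\<in>I. K (g k))" if "finite I" for g :: "nat \<Rightarrow> real poly" and I
    using that by (induction I rule: finite_induct) (simp_all add: K0 add)
  have "K p = K (\<Sum>k\<le>degree p. smult (coeff p k) (monom 1 k))"
    by (simp add: smult_monom poly_as_sum_of_monoms)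
  also have "\<dots> = (\<Sum>k\<le>degree p. coeff p k * K (monom 1 k))"
    by (simp add: Ksum smult)
  also have "\<dots> = 0" using basis deg by simp
  finally show ?thesis .
qed

definition nodal :: "real^'s \<Rightarrow> real poly" where
  "nodal c = (\<Prod>i\<in>UNIV. [:- c $ i, 1:])"

lemma poly_nodal: "poly (nodal c) x = (\<Prod>i\<in>UNIV. (x - c $ i))"
  by (simp add: nodal_def poly_prod)

lemma poly_nodal_node: "poly (nodal c) (c $ i) = 0"
  by (auto simp: poly_nodal)

lemma degree_nodal: "degree (nodal (c :: real^'s)) = CARD('s)"
  unfolding nodal_def by (subst degree_prod_eq_sum_degree) auto

lemma lead_coeff_nodal: "lead_coeff (nodal c) = 1"
  unfolding nodal_def by (simp add: lead_coeff_prod)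

text \<open>The argument behind Gauss quadrature, for an arbitrary linear functional \<open>L\<close>: modulo the nodal
polynomial the degree of \<open>p\<close> drops below the number of nodes, and the multiple of the nodal
polynomial split off is invisible both to the nodes and, by orthogonality, to \<open>L\<close>.\<close>

lemma quadrature_exact:
  fixes L :: "real poly \<Rightarrow> real" and w c :: "real^'s"
  assumes add: "\<And>p q. L (p + q) = L p + L q" and smult: "\<And>a p. L (smult a p) = a * L p"
    and moments: "\<And>k. k < CARD('s) \<Longrightarrow> (\<Sum>i\<in>UNIV. w $ i * (c $ i) ^ k) = L (monom 1 k)"
    and orth: "\<And>k. k < m \<Longrightarrow> L (monom 1 k * nodal c) = 0"
    and deg: "degree p < CARD('s) + m"
  shows "(\<Sum>i\<in>UNIV. w $ i * poly p (c $ i)) = L p"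
proof -
  define K where "K p = (\<Sum>i\<in>UNIV. w $ i * poly p (c $ i)) - L p" for p
  have K_add: "K (p + q) = K p + K q" for p q
    by (simp add: K_def add algebra_simps sum.distrib)
  have K_smult: "K (smult a p) = a * K p" for a p
    by (simp add: K_def smult algebra_simps sum_distrib_left)
  have low: "K r = 0" if "degree r < CARD('s)" for r
    by (rule poly_functional_eq_0[of K, OF K_add K_smult _ that])
       (simp add: K_def poly_monom moments)
  let ?q = "p div nodal c" and ?r = "p mod nodal c"
  have M0: "nodal c \<noteq> 0" using lead_coeff_nodal[of c] by auto
  have r: "degree ?r < CARD('s)"
    using degree_mod_less[OF M0, of p] degree_nodal[of c] by auto
  have "K (?q * nodal c) = 0"
  proof (cases "?q = 0")
    case True
    then show ?thesis using K_smult[of 0 0] by simp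
  next
    case False
    then have dq: "degree (?q * nodal c) = degree ?q + CARD('s)"
      by (simp add: degree_mult_eq M0 degree_nodal)
    then have "degree (?q * nodal c + ?r) = degree ?q + CARD('s)"
      using r by (subst degree_add_eq_left) auto
    then have "degree ?q < m" using deg by simp
    then show ?thesis
      by (rule poly_functional_eq_0[of "\<lambda>q. K (q * nodal c)", rotated 3])
         (simp_all add: distrib_right K_add K_smult, simp add: K_def orth poly_nodal_node)
  qed
  then have "K p = 0"
    using K_add[of "?q * nodal c" ?r] low[OF r] by simp
  then show ?thesis by (simp add: K_def)
qed

lemma collocation_moments:
  fixes c b d :: "real^'s"
  assumes "collocation_coeffs c b d A B" and "k < CARD('s)"
  shows "(\<Sum>i\<in>UNIV. b $ i * (c $ i) ^ k) = 1 / ((real k + 1) * (real k + 2))"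
    and "(\<Sum>i\<in>UNIV. d $ i * (c $ i) ^ k) = 1 / (real k + 1)"
    and "(\<Sum>j\<in>UNIV. A $ i $ j * (c $ j - 1) ^ k) = (c $ i) ^ (k + 2) / ((real k + 1) * (real k + 2))"
    and "(\<Sum>j\<in>UNIV. B $ i $ j * (c $ j - 1) ^ k) = (c $ i) ^ (k + 1) / (real k + 1)"
proof -
  have pos: "real k + 1 \<noteq> 0" "real k + 2 \<noteq> 0" by linarith+
  have "1 = (real k + 2) * (real k + 1) * (b \<bullet> vpow c k)"
       "1 = (real k + 1) * (d \<bullet> vpow c k)"
       "vpow c (k + 2) $ i = (((real k + 2) * (real k + 1)) *\<^sub>R (A *v vpow (c - 1) k)) $ i"
       "vpow c (k + 1) $ i = ((real k + 1) *\<^sub>R (B *v vpow (c - 1) k)) $ i"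
    using assms by (auto simp: collocation_coeffs_def)
  then have eqs:
       "1 = (real k + 2) * (real k + 1) * (\<Sum>i\<in>UNIV. b $ i * (c $ i) ^ k)"
       "1 = (real k + 1) * (\<Sum>i\<in>UNIV. d $ i * (c $ i) ^ k)"
       "(c $ i) ^ (k + 2) = ((real k + 2) * (real k + 1)) * (\<Sum>j\<in>UNIV. A $ i $ j * (c $ j - 1) ^ k)"
       "(c $ i) ^ (k + 1) = (real k + 1) * (\<Sum>j\<in>UNIV. B $ i $ j * (c $ j - 1) ^ k)"
    by (simp_all add: vpow_def inner_vec_def matrix_vector_mult_def)
  have divide: "x = q / a" if "q = a * x" "a \<noteq> 0" for a q x :: real
    using that by simp
  show "(\<Sum>i\<in>UNIV. b $ i * (c $ i) ^ k) = 1 / ((real k + 1) * (real k + 2))"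
    using divide[OF eqs(1)] pos by (simp add: mult.commute)
  show "(\<Sum>i\<in>UNIV. d $ i * (c $ i) ^ k) = 1 / (real k + 1)"
    by (rule divide[OF eqs(2) pos(1)])
  show "(\<Sum>j\<in>UNIV. A $ i $ j * (c $ j - 1) ^ k) = (c $ i) ^ (k + 2) / ((real k + 1) * (real k + 2))"
    using divide[OF eqs(3)] pos by (simp add: mult.commute)
  show "(\<Sum>j\<in>UNIV. B $ i $ j * (c $ j - 1) ^ k) = (c $ i) ^ (k + 1) / (real k + 1)"
    by (rule divide[OF eqs(4) pos(1)])
qed

lemma antideriv_orth:
  assumes "\<forall>k\<in>{0, 1::nat}. integral {0..1} (\<lambda>\<xi>. \<xi> ^ k * (\<Prod>i\<in>UNIV. (\<xi> - c $ i))) = 0"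
    and "k < 2"
  shows "poly (antideriv (monom 1 k * nodal c)) 1 = 0"
proof -
  have "poly (monom 1 k * nodal c) = (\<lambda>\<xi>. \<xi> ^ k * (\<Prod>i\<in>UNIV. (\<xi> - c $ i)))"
    by (rule ext) (simp add: poly_monom poly_nodal)
  moreover have "k \<in> {0, 1}" using assms(2) by auto
  ultimately have "integral {0..1} (poly (monom 1 k * nodal c)) = 0"
    using assms(1)[rule_format, of k] by (simp only:)
  then show ?thesis by (simp only: integral_poly[OF zero_le_one] poly_antideriv_0 diff_0_right)
qed

lemma derivative_weights_exact:
  fixes c b d :: "real^'s"
  assumes coeffs: "collocation_coeffs c b d A B"
    and orth: "\<forall>k\<in>{0, 1::nat}. integral {0..1} (\<lambda>\<xi>. \<xi> ^ k * (\<Prod>i\<in>UNIV. (\<xi> - c $ i))) = 0"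
    and deg: "degree p \<le> CARD('s) + 1"
  shows "(\<Sum>i\<in>UNIV. d $ i * poly p (c $ i)) = poly (antideriv p) 1"
proof (rule quadrature_exact[where m = 2])
  show "poly (antideriv (monom 1 k * nodal c)) 1 = 0" if "k < 2" for k
    by (rule antideriv_orth[OF orth that])
qed (use deg in \<open>simp_all add: antideriv_add antideriv_smult antideriv_monom poly_monom
       collocation_moments(2)[OF coeffs] add.commute\<close>)

lemma value_weights_exact:
  fixes c b d :: "real^'s"
  assumes coeffs: "collocation_coeffs c b d A B"
    and orth: "\<forall>k\<in>{0, 1::nat}. integral {0..1} (\<lambda>\<xi>. \<xi> ^ k * (\<Prod>i\<in>UNIV. (\<xi> - c $ i))) = 0"
    and deg: "degree p \<le> CARD('s)"
  shows "(\<Sum>i\<in>UNIV. b $ i * poly p (c $ i)) = poly (antideriv (antideriv p)) 1"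
proof (rule quadrature_exact[where m = 1])
  fix k :: nat assume "k < 1"
  then show "poly (antideriv (antideriv (monom 1 k * nodal c))) 1 = 0"
    using antideriv_orth[OF orth, of 0] antideriv_orth[OF orth, of 1]
    by (simp add: antideriv_antideriv monom_0 monom_Suc)
qed (use deg in \<open>simp_all add: antideriv_add antideriv_smult antideriv_monom poly_monom
       collocation_moments(1)[OF coeffs] add.commute\<close>)

text \<open>The bracket is the leading error coefficient of the formula for the \<open>i\<close>-th stage derivative. It is
the value at \<open>c\<^sub>i\<close> of the polynomial \<open>P(x)\<close>, the integral of the nodal polynomial from \<open>1\<close> to
\<open>1 + x\<close>: the nodes \<open>c\<^sub>j - 1\<close> are the roots of the shifted nodal polynomial, and a monomial of
degree \<open>s\<close> differs from it by a polynomial that row \<open>i\<close> of \<open>B\<close> integrates exactly.\<close>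

lemma derivative_weights_annihilate_stage_defect:
  fixes c b d :: "real^'s"
  assumes coeffs: "collocation_coeffs c b d A B"
    and double_int:
      "integral {0..1} (\<lambda>t. integral {0..1 + t} (\<lambda>\<xi>. \<Prod>i\<in>UNIV. (\<xi> - c $ i))) = 0"
    and orth: "\<forall>k\<in>{0, 1::nat}. integral {0..1} (\<lambda>\<xi>. \<xi> ^ k * (\<Prod>i\<in>UNIV. (\<xi> - c $ i))) = 0"
  shows "(\<Sum>i\<in>UNIV. d $ i * ((c $ i) ^ (CARD('s) + 1) / (real CARD('s) + 1)
            - (\<Sum>j\<in>UNIV. B $ i $ j * (c $ j - 1) ^ CARD('s)))) = 0"
proof -
  let ?s = "CARD('s)"
  define M where "M = pcompose (nodal c) [:1, 1:]"
  define P where "P = pcompose (antideriv (nodal c)) [:1, 1:]"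
  have M_node: "poly M (c $ j - 1) = 0" for j
    by (simp add: M_def poly_pcompose poly_nodal_node)
  have degM: "degree M = ?s" by (simp add: M_def degree_pcompose degree_nodal)
  have lcM: "lead_coeff M = 1" by (simp add: M_def lead_coeff_comp lead_coeff_nodal)
  have int0: "poly (antideriv (nodal c)) 1 = 0"
    using antideriv_orth[OF orth, of 0] by (simp add: monom_0)
  have P0: "poly P 0 = 0" by (simp add: P_def poly_pcompose int0)
  have "pderiv P = M"
    by (simp add: P_def M_def pderiv_pcompose pderiv_antideriv pderiv_pCons)
  then have P: "P = antideriv M" using antideriv_pderiv[of P] P0 by simp
  have E: "(c $ i) ^ (?s + 1) / (real ?s + 1)
            - (\<Sum>j\<in>UNIV. B $ i $ j * (c $ j - 1) ^ ?s) = poly P (c $ i)" for i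
  proof -
    let ?p = "monom 1 ?s - M"
    have "degree ?p < ?s"
    proof (rule degree_lessI)
      show "?p \<noteq> 0 \<or> 0 < ?s" by simp
      show "\<forall>k\<ge>?s. coeff ?p k = 0"
        using degM lcM by (auto simp: coeff_monom coeff_eq_0 le_less)
    qed
    then have "(\<Sum>j\<in>UNIV. (\<chi> j. B $ i $ j) $ j * poly ?p ((c - 1) $ j)) = poly (antideriv ?p) (c $ i)"
      by (intro quadrature_exact[where m = 0])
         (simp_all add: antideriv_add antideriv_smult antideriv_monom poly_monom
           collocation_moments(4)[OF coeffs] add.commute)
    moreover have "antideriv ?p = antideriv (monom 1 ?s) - P"
      using antideriv_add[of ?p M] by (simp add: P algebra_simps)
    ultimately show ?thesis
      by (simp add: M_node poly_monom antideriv_monom add.commute)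
  qed
  have "degree P \<le> ?s + 1" using degree_antideriv[of M] by (simp add: P degM)
  then have "(\<Sum>i\<in>UNIV. d $ i * poly P (c $ i)) = poly (antideriv P) 1"
    by (rule derivative_weights_exact[OF coeffs orth])
  also have "\<dots> = integral {0..1} (poly P)"
    by (simp add: integral_poly poly_antideriv_0)
  also have "\<dots> = integral {0..1} (\<lambda>t. integral {0..1 + t} (poly (nodal c)))"
    by (rule integral_cong) (simp add: integral_poly poly_antideriv_0 P_def poly_pcompose)
  also have "\<dots> = 0" using double_int by (simp add: poly_nodal[abs_def])
  finally show ?thesis by (simp only: E)
qed

section \<open>Orders of vanishing as the step size tends to zero\<close>

lemma power_bigo_power:
  assumes "m \<le> n"
  shows "(\<lambda>h::real. h ^ n) \<in> O[at_right 0](\<lambda>h. h ^ m)"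
proof (rule bigoI[of _ 1])
  have "\<forall>\<^sub>F h::real in at_right 0. 0 < h \<and> h < 1"
    by (auto simp: eventually_at_right_field intro: exI[of _ 1])
  then show "\<forall>\<^sub>F h::real in at_right 0. norm (h ^ n) \<le> 1 * norm (h ^ m)"
    by eventually_elim (use assms in \<open>simp add: power_decreasing\<close>)
qed

lemma bigo_power_mono:
  assumes "f \<in> O[at_right 0](\<lambda>h::real. h ^ n)" "m \<le> n"
  shows "f \<in> O[at_right 0](\<lambda>h. h ^ m)"
  using assms power_bigo_power landau_o.big_trans by blast

lemma bigo_cmult:
  assumes "f \<in> O[F](g)"
  shows "(\<lambda>x. (c::real) * f x) \<in> O[F](g)"
  using assms by (cases "c = 0") simp_all

lemma bigo_power_mult:
  assumes "f \<in> O[at_right 0](\<lambda>h::real. h ^ n)"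
  shows "(\<lambda>h. h ^ m * f h) \<in> O[at_right 0](\<lambda>h. h ^ (m + n))"
  unfolding power_add by (rule landau_o.big.mult_left[OF assms])

lemma val_acc_mono: "val_acc n y t u \<Longrightarrow> m \<le> n \<Longrightarrow> val_acc m y t u"
  unfolding val_acc_def by (rule bigo_power_mono)

lemma stage_acc_mono: "stage_acc n c y t Y \<Longrightarrow> m \<le> n \<Longrightarrow> stage_acc m c y t Y"
  unfolding stage_acc_def by (blast intro: bigo_power_mono)

section \<open>Taylor expansion of collocation formulas along the solution\<close>

text \<open>A chain of successive derivatives as one indexed family, the form in which Taylor's theorem and
the changes of index in the error expansions are convenient.\<close>

definition derivs_on :: "(nat \<Rightarrow> real \<Rightarrow> real) \<Rightarrow> nat \<Rightarrow> real set \<Rightarrow> bool" where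
  "derivs_on D n J \<longleftrightarrow>
     (\<forall>k<n. \<forall>t\<in>J. (D k has_real_derivative D (Suc k) t) (at t within J)) \<and>
     (\<forall>k\<le>n. bounded (D k ` J))"

lemma Ck_on_continuous: "Ck_on k f S \<Longrightarrow> continuous_on S f"
  by (cases k) (auto simp: continuous_on_eq_continuous_within intro: has_derivative_continuous)

lemma Ck_on_Suc_imp: "Ck_on (Suc k) f S \<Longrightarrow> Ck_on k f S"
proof (induction k arbitrary: f)
  case 0
  then show ?case using Ck_on_continuous by fastforce
next
  case (Suc k)
  then show ?case by (metis Ck_on.simps(2))
qed

lemma Ck_on_mono: "Ck_on n f S \<Longrightarrow> m \<le> n \<Longrightarrow> Ck_on m f S"
  by (induction n) (auto simp: le_Suc_eq dest: Ck_on_Suc_imp simp del: Ck_on.simps)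

lemma Ck_on_derivative_chain:
  "Ck_on n y J \<Longrightarrow> \<exists>D. D 0 = y \<and>
     (\<forall>k<n. \<forall>t\<in>J. (D k has_real_derivative D (Suc k) t) (at t within J)) \<and>
     (\<forall>k\<le>n. continuous_on J (D k))"
proof (induction n arbitrary: y)
  case 0
  then show ?case by (intro exI[of _ "\<lambda>_. y"]) simp
next
  case (Suc n)
  obtain y' where y': "\<forall>t\<in>J. (y has_derivative y' t) (at t within J)" "\<forall>v. Ck_on n (\<lambda>t. y' t v) J"
    using Suc.prems by auto
  obtain E where E: "E 0 = (\<lambda>t. y' t 1)"
      "\<forall>k<n. \<forall>t\<in>J. (E k has_real_derivative E (Suc k) t) (at t within J)"
      "\<forall>k\<le>n. continuous_on J (E k)"
    using Suc.IH y'(2) by blast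
  have "(y has_real_derivative y' t 1) (at t within J)" if "t \<in> J" for t
  proof -
    have d: "(y has_derivative y' t) (at t within J)" using y'(1) that by blast
    then interpret bounded_linear "y' t" by (rule has_derivative_bounded_linear)
    have "y' t v = y' t 1 * v" for v
      using scaleR[of v 1] by (simp add: algebra_simps)
    then have "y' t = (*) (y' t 1)" by (rule ext)
    then show ?thesis using d by (simp add: has_field_derivative_def)
  qed
  then have "((case_nat y E k) has_real_derivative (case_nat y E (Suc k)) t) (at t within J)"
    if "k < Suc n" "t \<in> J" for k t
    using that E(1,2) by (cases k) auto
  moreover have "continuous_on J (case_nat y E k)" if "k \<le> Suc n" for k
    using that E(3) Ck_on_continuous[OF Suc.prems] by (cases k) auto
  ultimately show ?case
    by (intro exI[of _ "case_nat y E"]) auto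
qed

text \<open>The derivatives of \<open>y\<close> supplied by its smoothness agree on the interval with \<open>dy\<close> and with the
right-hand side along the solution; exchanging these two members of the chain makes them the
given functions everywhere, so that no side conditions are left when they are rewritten.\<close>

lemma solution_derivs_on:
  assumes "smooth_ivp_solution q f t0 T y0 dy0 y dy" and "3 \<le> q"
  defines "J \<equiv> {t0..t0+T}"
  obtains D where "derivs_on D q J" "D 0 = y" "D 1 = dy" "D 2 = (\<lambda>t. f t (y t) (dy t))"
proof -
  have T: "0 < T" and Ck: "Ck_on q y J"
    and d1: "\<And>t. t \<in> J \<Longrightarrow> (y has_real_derivative dy t) (at t within J)"
    and d2: "\<And>t. t \<in> J \<Longrightarrow> (dy has_real_derivative f t (y t) (dy t)) (at t within J)"
    using assms(1) unfolding smooth_ivp_solution_def J_def by blast+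
  obtain E where E: "E 0 = y"
      "\<And>k t. k < q \<Longrightarrow> t \<in> J \<Longrightarrow> (E k has_real_derivative E (Suc k) t) (at t within J)"
      "\<And>k. k \<le> q \<Longrightarrow> continuous_on J (E k)"
    using Ck_on_derivative_chain[OF Ck] by blast
  have unique: "a = b"
    if "(g has_real_derivative a) (at t within J)" "(g has_real_derivative b) (at t within J)" "t \<in> J"
    for g :: "real \<Rightarrow> real" and a b t
    using vector_derivative_unique_within_closed_interval[of t0 "t0 + T" t g a b] that T
    by (simp add: has_real_derivative_iff_has_vector_derivative J_def)
  have E1: "E 1 t = dy t" if "t \<in> J" for t
    using unique[of "E 0"] E(1) E(2)[of 0 t] d1[of t] that assms(2) by auto
  have E2: "E 2 t = f t (y t) (dy t)" if "t \<in> J" for t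
  proof (rule unique[OF _ d2 that])
    have "(E 1 has_real_derivative E 2 t) (at t within J)"
      using E(2)[of 1 t] that assms(2) by (simp add: numeral_2_eq_2)
    then show "(dy has_real_derivative E 2 t) (at t within J)"
      by (rule has_field_derivative_transform_within[where d = 1]) (use that E1 in auto)
  qed fact
  define D where "D = (\<lambda>k. if k = 1 then dy else if k = 2 then (\<lambda>t. f t (y t) (dy t)) else E k)"
  have DE: "D k t = E k t" if "t \<in> J" for k t
    using that E1 E2 by (auto simp: D_def)
  have "(D k has_real_derivative D (Suc k) t) (at t within J)" if "k < q" "t \<in> J" for k t
    unfolding DE[OF that(2)]
    by (rule has_field_derivative_transform_within[OF E(2)[OF that], where d = 1])
       (use that DE in auto)
  moreover have "bounded (D k ` J)" if "k \<le> q" for k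
  proof -
    have "bounded (E k ` J)"
      by (rule compact_imp_bounded, rule compact_continuous_image)
         (use E(3)[OF that] in \<open>auto simp: J_def\<close>)
    moreover have "D k ` J = E k ` J" using DE by (intro image_cong) auto
    ultimately show ?thesis by simp
  qed
  ultimately have "derivs_on D q J" by (simp add: derivs_on_def)
  then show thesis by (rule that) (simp_all add: D_def E(1))
qed

lemma derivs_on_bigo_1:
  assumes "derivs_on D N J" "k \<le> N" "\<forall>\<^sub>F h in F. a h \<in> J"
  shows "(\<lambda>h. D k (a h)) \<in> O[F](\<lambda>_. 1)"
proof -
  obtain C where "\<forall>t\<in>J. norm (D k t) \<le> C"
    using assms(1,2) by (auto simp: derivs_on_def bounded_iff)
  then show ?thesis
    by (intro bigoI[of _ C] eventually_mono[OF assms(3)]) auto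
qed

text \<open>The base point may move with \<open>h\<close>, because the remainder is bounded uniformly over the interval,
and \<open>z\<close> may be negative, as it is for stages left of the grid point.\<close>

lemma taylor_bigo:
  assumes D: "derivs_on D N J" and "convex J" "m + n \<le> N"
    and a: "\<forall>\<^sub>F h in at_right 0. a h \<in> J" and b: "\<forall>\<^sub>F h in at_right 0. a h + z * h \<in> J"
  shows "(\<lambda>h. D m (a h + z * h) - (\<Sum>k<n. D (m + k) (a h) * (z * h) ^ k / fact k))
           \<in> O[at_right 0](\<lambda>h. h ^ n)"
proof (cases n)
  case 0
  then show ?thesis using derivs_on_bigo_1[OF D _ b, of m] assms(3) by simp
next
  case (Suc l)
  obtain C where C: "\<And>t. t \<in> J \<Longrightarrow> norm (D (m + Suc l) t) \<le> C"
  proof -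
    have "bounded (D (m + Suc l) ` J)"
      using D assms(3) Suc unfolding derivs_on_def by blast
    then show thesis using that by (auto simp: bounded_iff)
  qed
  have bound: "norm (D m (w + z * h) - (\<Sum>k<n. D (m + k) w * (z * h) ^ k / fact k))
          \<le> C * \<bar>z\<bar> ^ n / fact l * norm (h ^ n)" if "w \<in> J" "w + z * h \<in> J" for w h
  proof -
    have "(D (m + i) has_real_derivative D (m + Suc i) t) (at t within J)" if "t \<in> J" "i \<le> l" for i t
      using D assms(3) Suc that by (simp add: derivs_on_def)
    from field_Taylor[of J l "\<lambda>k. D (m + k)" C w "w + z * h", OF assms(2) this C \<open>w \<in> J\<close> that(2)]
    have "norm (D m (w + z * h) - (\<Sum>k\<le>l. D (m + k) w * (z * h) ^ k / fact k))
        \<le> C * norm (z * h) ^ Suc l / fact l" by simp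
    also have "\<dots> = C * \<bar>z\<bar> ^ n / fact l * norm (h ^ n)"
      by (simp only: Suc real_norm_def abs_mult power_mult_distrib power_abs) (simp add: mult_ac)
    finally show ?thesis by (simp only: Suc lessThan_Suc_atMost)
  qed
  show ?thesis
  proof (rule bigoI)
    show "\<forall>\<^sub>F h in at_right 0.
        norm (D m (a h + z * h) - (\<Sum>k<n. D (m + k) (a h) * (z * h) ^ k / fact k))
          \<le> C * \<bar>z\<bar> ^ n / fact l * norm (h ^ n)"
      using a b by eventually_elim (rule bound)
  qed
qed

text \<open>All four formulas of the method replace the remainder after the first \<open>r\<close> Taylor terms of
\<open>D m\<close> by a weighted sum of values of \<open>D (m + r)\<close>: \<open>r = 2\<close> for values and \<open>r = 1\<close> for
derivatives. Expanding both sides in powers of \<open>h\<close>, the \<open>k\<close>-th coefficient is the error that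
the weights make on the \<open>k\<close>-th monomial.\<close>

lemma collocation_defect:
  fixes w X :: "real^'s"
  assumes D: "derivs_on D N J" and J: "convex J" and N: "m + r + n \<le> N"
    and a: "\<forall>\<^sub>F h in at_right 0. a h \<in> J" and b: "\<forall>\<^sub>F h in at_right 0. a h + x * h \<in> J"
    and X: "\<And>j. \<forall>\<^sub>F h in at_right 0. a h + X $ j * h \<in> J"
  shows "(\<lambda>h. D m (a h + x * h) - (\<Sum>k<r. D (m + k) (a h) * (x * h) ^ k / fact k)
            - h ^ r * (\<Sum>j\<in>UNIV. w $ j * D (m + r) (a h + X $ j * h))
            - (\<Sum>k<n. h ^ (r + k) * D (m + r + k) (a h) *
                (x ^ (r + k) / fact (r + k) - (\<Sum>j\<in>UNIV. w $ j * (X $ j) ^ k) / fact k)))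
           \<in> O[at_right 0](\<lambda>h. h ^ (r + n))" (is "?f \<in> _")
proof -
  define R where "R h = D m (a h + x * h) - (\<Sum>k<r + n. D (m + k) (a h) * (x * h) ^ k / fact k)" for h
  define Q where "Q j h = D (m + r) (a h + X $ j * h)
      - (\<Sum>k<n. D (m + r + k) (a h) * (X $ j * h) ^ k / fact k)" for j h
  have split: "(\<Sum>k<r + n. g k) = (\<Sum>k<r. g k) + (\<Sum>k<n. g (r + k))" for g :: "nat \<Rightarrow> real"
    by (induction n) simp_all
  have "?f = (\<lambda>h. R h - h ^ r * (\<Sum>j\<in>UNIV. w $ j * Q j h))"
  proof
    fix h
    have "(\<Sum>j\<in>UNIV. w $ j * (\<Sum>k<n. D (m + r + k) (a h) * (X $ j * h) ^ k / fact k))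
        = (\<Sum>k<n. h ^ k * D (m + r + k) (a h) * ((\<Sum>j\<in>UNIV. w $ j * (X $ j) ^ k) / fact k))"
      unfolding sum_distrib_left sum_divide_distrib
      by (subst sum.swap) (simp add: power_mult_distrib mult_ac)
    then show "?f h = R h - h ^ r * (\<Sum>j\<in>UNIV. w $ j * Q j h)"
      by (simp add: R_def Q_def split right_diff_distrib sum_subtractf sum_distrib_left
          power_add power_mult_distrib mult_ac add.assoc)
  qed
  moreover have "R \<in> O[at_right 0](\<lambda>h. h ^ (r + n))"
    unfolding R_def by (rule taylor_bigo[OF D J _ a b]) (use N in simp)
  moreover have "Q j \<in> O[at_right 0](\<lambda>h. h ^ n)" for j
    unfolding Q_def by (rule taylor_bigo[OF D J N a X])
  then have "(\<lambda>h. h ^ r * (\<Sum>j\<in>UNIV. w $ j * Q j h)) \<in> O[at_right 0](\<lambda>h. h ^ (r + n))"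
    by (intro bigo_power_mult big_sum_in_bigo bigo_cmult)
  ultimately show ?thesis by (simp add: sum_in_bigo)
qed

text \<open>The first defective term is kept explicitly: in the stage derivatives it is what the weights \<open>d\<close>
later annihilate.\<close>

lemma collocation_defect_leading:
  fixes w X :: "real^'s"
  assumes D: "derivs_on D N J" and J: "convex J" and N: "m + r + Suc n \<le> N"
    and a: "\<forall>\<^sub>F h in at_right 0. a h \<in> J" and b: "\<forall>\<^sub>F h in at_right 0. a h + x * h \<in> J"
    and X: "\<And>j. \<forall>\<^sub>F h in at_right 0. a h + X $ j * h \<in> J"
    and moments: "\<And>k. k < n \<Longrightarrow>
      (\<Sum>j\<in>UNIV. w $ j * (X $ j) ^ k) / fact k = x ^ (r + k) / fact (r + k)"
  shows "(\<lambda>h. D m (a h + x * h) - (\<Sum>k<r. D (m + k) (a h) * (x * h) ^ k / fact k)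
            - h ^ r * (\<Sum>j\<in>UNIV. w $ j * D (m + r) (a h + X $ j * h))
            - h ^ (r + n) * D (m + r + n) (a h) *
                (x ^ (r + n) / fact (r + n) - (\<Sum>j\<in>UNIV. w $ j * (X $ j) ^ n) / fact n))
           \<in> O[at_right 0](\<lambda>h. h ^ (r + Suc n))"
  using collocation_defect[OF D J N a b X, of w] by (simp add: moments)

lemma collocation_defect_exact:
  fixes w X :: "real^'s"
  assumes D: "derivs_on D N J" and J: "convex J" and N: "m + r + n \<le> N"
    and a: "\<forall>\<^sub>F h in at_right 0. a h \<in> J" and b: "\<forall>\<^sub>F h in at_right 0. a h + x * h \<in> J"
    and X: "\<And>j. \<forall>\<^sub>F h in at_right 0. a h + X $ j * h \<in> J"
    and moments: "\<And>k. k < n \<Longrightarrow>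
      (\<Sum>j\<in>UNIV. w $ j * (X $ j) ^ k) / fact k = x ^ (r + k) / fact (r + k)"
  shows "(\<lambda>h. D m (a h + x * h) - (\<Sum>k<r. D (m + k) (a h) * (x * h) ^ k / fact k)
            - h ^ r * (\<Sum>j\<in>UNIV. w $ j * D (m + r) (a h + X $ j * h)))
           \<in> O[at_right 0](\<lambda>h. h ^ (r + n))"
  using collocation_defect[OF D J N a b X, of w] by (simp add: moments)

text \<open>The order conditions in the normalisation of \<open>collocation_defect\<close>.\<close>

lemma fact_moments:
  fixes x S :: real
  shows "S = x ^ (k + 1) / (real k + 1) \<Longrightarrow> S / fact k = x ^ (1 + k) / fact (1 + k)"
    and "S = x ^ (k + 2) / ((real k + 1) * (real k + 2)) \<Longrightarrow> S / fact k = x ^ (2 + k) / fact (2 + k)"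
  by (simp_all add: add.commute mult_ac)

section \<open>Sensitivity of the right-hand side near the solution\<close>

text \<open>The operator norm of the derivative is bounded on \<open>K\<close>, because it is controlled by the values on
the finitely many basis vectors, each of which depends continuously on the point.\<close>

lemma C1_imp_lipschitz_on_compact:
  fixes f :: "'a::euclidean_space \<Rightarrow> 'b::real_normed_vector"
  assumes f: "Ck_on 1 f S" and K: "compact K" "convex K" "K \<subseteq> S"
  obtains L where "L-lipschitz_on K f"
proof -
  obtain f' where d: "\<And>x. x \<in> S \<Longrightarrow> (f has_derivative f' x) (at x within S)"
    and cont: "\<And>v. continuous_on S (\<lambda>x. f' x v)"
    using f by auto
  have "\<exists>C. \<forall>x\<in>K. norm (f' x v) \<le> C" for v
  proof -
    have "compact ((\<lambda>x. f' x v) ` K)"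
      using cont K by (intro compact_continuous_image) (auto intro: continuous_on_subset)
    then show ?thesis using compact_imp_bounded by (fastforce simp: bounded_iff)
  qed
  then obtain C where C: "\<And>v x. x \<in> K \<Longrightarrow> norm (f' x v) \<le> C v" by metis
  have "(max 0 (\<Sum>i\<in>Basis. C i))-lipschitz_on K f"
  proof (rule bounded_derivative_imp_lipschitz[OF _ K(2)])
    show dK: "(f has_derivative f' x) (at x within K)" if "x \<in> K" for x
      using d that K(3) by (blast intro: has_derivative_subset)
    show "onorm (f' x) \<le> max 0 (\<Sum>i\<in>Basis. C i)" if "x \<in> K" for x
    proof -
      have "onorm (f' x) \<le> (\<Sum>i\<in>Basis. norm (f' x i))"
        by (rule onorm_componentwise[OF has_derivative_bounded_linear[OF dK[OF that]]])
      also have "\<dots> \<le> (\<Sum>i\<in>Basis. C i)" by (intro sum_mono C that)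
      finally show ?thesis by simp
    qed
  qed simp
  then show thesis by (rule that)
qed

text \<open>Applied to the solution and its derivative, this turns closeness in time into closeness of the
arguments of the right-hand side.\<close>

lemma derivs_on_lipschitz:
  assumes "derivs_on D N J" "k < N" "convex J"
  obtains L where "L-lipschitz_on J (D k)"
proof -
  have "bounded (D (Suc k) ` J)" using assms(1,2) by (simp add: derivs_on_def)
  then obtain C where C: "\<And>t. t \<in> J \<Longrightarrow> norm (D (Suc k) t) \<le> C"
    by (auto simp: bounded_iff)
  have "(max 0 C)-lipschitz_on J (D k)"
  proof (rule lipschitz_onI)
    fix a b assume "a \<in> J" "b \<in> J"
    moreover have "norm (D (Suc k) t) \<le> max 0 C" if "t \<in> J" for t
      using C[OF that] by simp
    ultimately have "norm (D k a - D k b) \<le> max 0 C * norm (a - b)"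
      using assms(1,2)
      by (intro field_differentiable_bound[OF assms(3)]) (auto simp: derivs_on_def)
    then show "dist (D k a) (D k b) \<le> max 0 C * dist a b" by (simp add: dist_norm)
  qed simp
  then show thesis by (rule that)
qed

lemma dist_triple_le:
  fixes a b c a' b' c' :: real
  shows "dist (a, b, c) (a', b', c') \<le> \<bar>a - a'\<bar> + (\<bar>b - b'\<bar> + \<bar>c - c'\<bar>)"
proof -
  have "dist (a, b, c) (a', b', c') \<le> dist a a' + dist (b, c) (b', c')"
    unfolding dist_Pair_Pair by (rule sqrt_sum_squares_le_sum) simp_all
  also have "dist (b, c) (b', c') \<le> dist b b' + dist c c'"
    unfolding dist_Pair_Pair by (rule sqrt_sum_squares_le_sum) simp_all
  finally show ?thesis by (simp add: dist_real_def)
qed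

text \<open>An initial value problem with a solution \<open>D 0\<close>, whose derivative is \<open>D 1\<close>; the differential
equation is an identity of functions, as obtained in \<open>solution_derivs_on\<close>.\<close>

locale smooth_ivp =
  fixes f :: "real \<Rightarrow> real \<Rightarrow> real \<Rightarrow> real" and J :: "real set" and D :: "nat \<Rightarrow> real \<Rightarrow> real" and N :: nat
  assumes compact_J: "compact J" and convex_J: "convex J"
    and derivs: "derivs_on D N J" and N: "3 \<le> N"
    and ode: "D 2 = (\<lambda>t. f t (D 0 t) (D 1 t))"
    and lipschitz: "\<exists>L. \<forall>t\<in>J. L-lipschitz_on UNIV (\<lambda>(u, v). f t u v)"
    and C2: "Ck_on 2 (\<lambda>(t, u, v). f t u v) (J \<times> UNIV)"

lemma smooth_ivp_solution_imp_smooth_ivp: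
  assumes sol: "smooth_ivp_solution q f t0 T y0 dy0 y dy" and q: "3 \<le> q"
  obtains D where "smooth_ivp f {t0..t0+T} D q" "D 0 = y" "D 1 = dy"
proof -
  obtain D where D: "derivs_on D q {t0..t0+T}" "D 0 = y" "D 1 = dy" "D 2 = (\<lambda>t. f t (y t) (dy t))"
    by (rule solution_derivs_on[OF sol q])
  have "Ck_on q (\<lambda>(t, u, v). f t u v) ({t0..t0+T} \<times> UNIV)"
    and "\<exists>L. \<forall>t\<in>{t0..t0+T}. L-lipschitz_on UNIV (\<lambda>(u, v). f t u v)"
    using sol by (simp_all add: smooth_ivp_solution_def)
  moreover from this have "Ck_on 2 (\<lambda>(t, u, v). f t u v) ({t0..t0+T} \<times> UNIV)"
    using q by (auto intro: Ck_on_mono simp del: Ck_on.simps)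
  ultimately have "smooth_ivp f {t0..t0+T} D q"
    using D q by unfold_locales auto
  then show thesis using that D by blast
qed

context smooth_ivp
begin

lemma rhs_diff_bigo:
  assumes tau: "\<forall>\<^sub>F h in F. \<tau> h \<in> J"
    and u: "(\<lambda>h. u h - u' h) \<in> O[F](\<phi>)" and v: "(\<lambda>h. v h - v' h) \<in> O[F](\<phi>)"
  shows "(\<lambda>h. f (\<tau> h) (u h) (v h) - f (\<tau> h) (u' h) (v' h)) \<in> O[F](\<phi>)"
proof -
  obtain L where L: "\<And>t. t \<in> J \<Longrightarrow> L-lipschitz_on UNIV (\<lambda>(u, v). f t u v)"
    using lipschitz by blast
  have bound: "norm (f t a b - f t a' b') \<le> L * norm (\<bar>a - a'\<bar> + \<bar>b - b'\<bar>)" if "t \<in> J" for t a b a' b'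
  proof -
    have "dist (f t a b) (f t a' b') \<le> L * dist (a, b) (a', b')"
      using lipschitz_onD[OF L[OF that], of "(a, b)" "(a', b')"] by simp
    also have "\<dots> \<le> L * (\<bar>a - a'\<bar> + \<bar>b - b'\<bar>)"
      using lipschitz_on_nonneg[OF L[OF that]] sqrt_sum_squares_le_sum_abs[of "a - a'" "b - b'"]
      by (intro mult_left_mono) (simp_all add: dist_Pair_Pair dist_real_def)
    finally show ?thesis by (simp add: dist_real_def)
  qed
  have "(\<lambda>h. f (\<tau> h) (u h) (v h) - f (\<tau> h) (u' h) (v' h)) \<in> O[F](\<lambda>h. \<bar>u h - u' h\<bar> + \<bar>v h - v' h\<bar>)"
  proof (rule bigoI)
    show "\<forall>\<^sub>F h in F. norm (f (\<tau> h) (u h) (v h) - f (\<tau> h) (u' h) (v' h))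
        \<le> L * norm (\<bar>u h - u' h\<bar> + \<bar>v h - v' h\<bar>)"
      using tau by eventually_elim (rule bound)
  qed
  also have "(\<lambda>h. \<bar>u h - u' h\<bar> + \<bar>v h - v' h\<bar>) \<in> O[F](\<phi>)"
    using u v by (intro sum_in_bigo) simp_all
  finally show ?thesis .
qed

lemma stage_rhs_error:
  fixes c :: "real^'s"
  assumes "\<forall>\<^sub>F h in at_right 0. stage_grid_in J c h (t h)"
    and "stage_acc m c (D 0) t Y" and "stage_acc m c (D 1) t dY"
  shows "(\<lambda>h. D 2 (t h + c $ i * h) - stage_rhs f c h (t h) (Y h) (dY h) $ i)
           \<in> O[at_right 0](\<lambda>h. h ^ m)"
  unfolding ode stage_rhs_def vec_lambda_beta
  by (rule rhs_diff_bigo, rule eventually_mono[OF assms(1)])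
     (use assms(2,3) in \<open>auto simp: stage_grid_in_def stage_acc_def\<close>)

text \<open>The coefficient \<open>g t\<close> is the partial derivative of \<open>f\<close> with respect to its last argument at the
solution at time \<open>t\<close>. It serves for all \<open>\<tau>\<close> near \<open>t\<close>, hence for all stages of one step, because
that partial derivative is Lipschitz continuous on a compact neighbourhood of the solution; the
mean value inequality for \<open>f\<close> minus its linear part then yields a remainder of second order.\<close>

lemma rhs_linearisation:
  obtains g M where "\<And>t. t \<in> J \<Longrightarrow> \<bar>g t\<bar> \<le> M"
    and "\<And>t \<tau> v. t \<in> J \<Longrightarrow> \<tau> \<in> J \<Longrightarrow> \<bar>D 1 \<tau> - v\<bar> \<le> 1 \<Longrightarrow>
      \<bar>f \<tau> (D 0 \<tau>) (D 1 \<tau>) - f \<tau> (D 0 \<tau>) v - g t * (D 1 \<tau> - v)\<bar>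
        \<le> M * (\<bar>\<tau> - t\<bar> + \<bar>D 1 \<tau> - v\<bar>) * \<bar>D 1 \<tau> - v\<bar>"
proof -
  obtain f' where f': "\<And>x. x \<in> J \<times> UNIV \<Longrightarrow>
      ((\<lambda>(t, u, v). f t u v) has_derivative f' x) (at x within J \<times> UNIV)"
    and f'_C1: "Ck_on 1 (\<lambda>x. f' x v) (J \<times> UNIV)" for v
    using C2 unfolding numeral_2_eq_2 One_nat_def Ck_on.simps(2)[of "Suc 0"] by blast
  define \<phi> where "\<phi> t u v = f' (t, u, v) (0, 0, 1)" for t u v
  have fz: "(f t u has_real_derivative \<phi> t u v) (at v within S)" if "t \<in> J" for t u v S
  proof -
    have "((\<lambda>v. (\<lambda>(t, u, v). f t u v) (t, u, v)) has_derivative (\<lambda>h. f' (t, u, v) (0, 0, h))) (at v within S)"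
      by (rule has_derivative_in_compose2[where t = "J \<times> UNIV" and g' = f', OF f', where s = UNIV and f = "\<lambda>v. (t, u, v)", THEN has_derivative_subset])
         (use that in \<open>auto intro!: derivative_eq_intros\<close>)
    moreover have "f' (t, u, v) (0, 0, h) = \<phi> t u v * h" for h
    proof -
      interpret bounded_linear "f' (t, u, v)"
        by (rule has_derivative_bounded_linear[OF f']) (use that in auto)
      show ?thesis using scaleR[of h "(0, 0, 1)"] by (simp add: \<phi>_def mult.commute)
    qed
    ultimately show ?thesis by (simp add: has_field_derivative_def)
  qed
  obtain L0 where L0: "L0-lipschitz_on J (D 0)"
    using derivs_on_lipschitz[OF derivs _ convex_J, of 0] N by auto
  obtain L1 where L1: "L1-lipschitz_on J (D 1)"
    using derivs_on_lipschitz[OF derivs _ convex_J, of 1] N by auto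
  have "bounded (D 0 ` J)" "bounded (D 1 ` J)"
    using derivs N by (simp_all add: derivs_on_def)
  then obtain R0 R1 where R: "\<And>t. t \<in> J \<Longrightarrow> \<bar>D 0 t\<bar> \<le> R0" "\<And>t. t \<in> J \<Longrightarrow> \<bar>D 1 t\<bar> \<le> R1"
    by (auto simp: bounded_iff)
  \<comment> \<open>a margin of 1 in the last component leaves room for the perturbed argument\<close>
  define K where "K = J \<times> {-R0..R0} \<times> {-(R1 + 1)..R1 + 1}"
  have K: "compact K" "convex K" "K \<subseteq> J \<times> UNIV"
    by (auto simp: K_def compact_J convex_J intro!: compact_Times convex_Times)
  obtain L where L: "L-lipschitz_on K (\<lambda>x. f' x (0, 0, 1))"
    by (rule C1_imp_lipschitz_on_compact[OF f'_C1 K])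
  have "bounded ((\<lambda>x. f' x (0, 0, 1)) ` K)"
    by (intro compact_imp_bounded compact_continuous_image K(1) lipschitz_on_continuous_on[OF L])
  then obtain C where C: "\<And>x. x \<in> K \<Longrightarrow> \<bar>f' x (0, 0, 1)\<bar> \<le> C"
    by (auto simp: bounded_iff)
  note nonneg = lipschitz_on_nonneg[OF L] lipschitz_on_nonneg[OF L0] lipschitz_on_nonneg[OF L1]
  define g where "g t = \<phi> t (D 0 t) (D 1 t)" for t
  define M where "M = max C (L * (1 + L0 + L1))"
  show thesis
  proof (rule that[of g M])
    fix t assume t: "t \<in> J"
    then have tK: "(t, D 0 t, D 1 t) \<in> K"
      using R[OF t] by (auto simp: K_def)
    then show "\<bar>g t\<bar> \<le> M"
      using C by (simp add: g_def \<phi>_def M_def le_max_iff_disj)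
    fix \<tau> v assume tau: "\<tau> \<in> J" and v: "\<bar>D 1 \<tau> - v\<bar> \<le> 1"
    let ?S = "closed_segment v (D 1 \<tau>)"
    have bound: "norm (\<phi> \<tau> (D 0 \<tau>) w - g t) \<le> M * (\<bar>\<tau> - t\<bar> + \<bar>D 1 \<tau> - v\<bar>)" if "w \<in> ?S" for w
    proof -
      have w: "\<bar>w - D 1 \<tau>\<bar> \<le> \<bar>D 1 \<tau> - v\<bar>"
        using that by (auto simp: closed_segment_eq_real_ivl split: if_splits)
      then have wK: "(\<tau>, D 0 \<tau>, w) \<in> K"
        using R[OF tau] v tau by (auto simp: K_def)
      have D0: "\<bar>D 0 \<tau> - D 0 t\<bar> \<le> L0 * \<bar>\<tau> - t\<bar>" and D1: "\<bar>D 1 \<tau> - D 1 t\<bar> \<le> L1 * \<bar>\<tau> - t\<bar>"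
        using lipschitz_onD[OF L0 tau t] lipschitz_onD[OF L1 tau t] by (simp_all add: dist_real_def)
      have "norm (\<phi> \<tau> (D 0 \<tau>) w - g t) \<le> L * dist (\<tau>, D 0 \<tau>, w) (t, D 0 t, D 1 t)"
        using lipschitz_onD[OF L wK tK] by (simp add: dist_real_def \<phi>_def g_def)
      also have "\<dots> \<le> L * ((1 + L0 + L1) * (\<bar>\<tau> - t\<bar> + \<bar>D 1 \<tau> - v\<bar>))"
      proof (rule mult_left_mono[OF order_trans[OF dist_triple_le]])
        have "\<bar>w - D 1 t\<bar> \<le> \<bar>D 1 \<tau> - v\<bar> + L1 * \<bar>\<tau> - t\<bar>" using w D1 by linarith
        moreover have "0 \<le> (L0 + L1) * \<bar>D 1 \<tau> - v\<bar>" using nonneg by simp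
        ultimately show "\<bar>\<tau> - t\<bar> + (\<bar>D 0 \<tau> - D 0 t\<bar> + \<bar>w - D 1 t\<bar>)
            \<le> (1 + L0 + L1) * (\<bar>\<tau> - t\<bar> + \<bar>D 1 \<tau> - v\<bar>)"
          using D0 by (simp add: algebra_simps)
      qed fact
      also have "\<dots> \<le> M * (\<bar>\<tau> - t\<bar> + \<bar>D 1 \<tau> - v\<bar>)"
        unfolding mult.assoc[symmetric] by (rule mult_right_mono) (auto simp: M_def)
      finally show ?thesis .
    qed
    have "norm ((f \<tau> (D 0 \<tau>) (D 1 \<tau>) - g t * D 1 \<tau>) - (f \<tau> (D 0 \<tau>) v - g t * v))
        \<le> M * (\<bar>\<tau> - t\<bar> + \<bar>D 1 \<tau> - v\<bar>) * norm (D 1 \<tau> - v)"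
    proof (rule field_differentiable_bound[where S = ?S])
      show "((\<lambda>w. f \<tau> (D 0 \<tau>) w - g t * w) has_field_derivative (\<phi> \<tau> (D 0 \<tau>) w - g t)) (at w within ?S)" for w
        by (rule derivative_eq_intros fz[OF tau] | simp)+
    qed (use bound in auto)
    then show "\<bar>f \<tau> (D 0 \<tau>) (D 1 \<tau>) - f \<tau> (D 0 \<tau>) v - g t * (D 1 \<tau> - v)\<bar>
        \<le> M * (\<bar>\<tau> - t\<bar> + \<bar>D 1 \<tau> - v\<bar>) * \<bar>D 1 \<tau> - v\<bar>"
      by (simp add: algebra_simps)
  qed
qed

lemma rhs_linearisation_bigo:
  obtains g M where "\<And>t. t \<in> J \<Longrightarrow> \<bar>g t\<bar> \<le> M"
    and "\<And>t z v n. \<lbrakk>\<forall>\<^sub>F h in at_right 0. t h \<in> J; \<forall>\<^sub>F h in at_right 0. t h + z * h \<in> J;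
        (\<lambda>h. D 1 (t h + z * h) - v h) \<in> O[at_right 0](\<lambda>h. h ^ Suc n)\<rbrakk> \<Longrightarrow>
      (\<lambda>h. f (t h + z * h) (D 0 (t h + z * h)) (D 1 (t h + z * h)) - f (t h + z * h) (D 0 (t h + z * h)) (v h)
             - g (t h) * (D 1 (t h + z * h) - v h)) \<in> O[at_right 0](\<lambda>h. h ^ Suc (Suc n))"
proof -
  obtain g M where gM: "\<And>t. t \<in> J \<Longrightarrow> \<bar>g t\<bar> \<le> M"
    "\<And>t \<tau> v. t \<in> J \<Longrightarrow> \<tau> \<in> J \<Longrightarrow> \<bar>D 1 \<tau> - v\<bar> \<le> 1 \<Longrightarrow>
      \<bar>f \<tau> (D 0 \<tau>) (D 1 \<tau>) - f \<tau> (D 0 \<tau>) v - g t * (D 1 \<tau> - v)\<bar>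
        \<le> M * (\<bar>\<tau> - t\<bar> + \<bar>D 1 \<tau> - v\<bar>) * \<bar>D 1 \<tau> - v\<bar>"
    using rhs_linearisation by blast
  show thesis
  proof (rule that[OF gM(1)])
    fix t z v n
    assume t: "\<forall>\<^sub>F h in at_right 0. t h \<in> J" and tz: "\<forall>\<^sub>F h in at_right 0. t h + z * h \<in> J"
      and v: "(\<lambda>h. D 1 (t h + z * h) - v h) \<in> O[at_right 0](\<lambda>h. h ^ Suc n)"
    define e where "e h = D 1 (t h + z * h) - v h" for h
    have e: "e \<in> O[at_right 0](\<lambda>h. h ^ Suc n)" using v by (simp add: e_def[abs_def])
    have e1: "e \<in> O[at_right 0](\<lambda>h. h)"
      using bigo_power_mono[OF e, of 1] by simp
    then obtain C where "C > 0" and C: "\<forall>\<^sub>F h in at_right 0. norm (e h) \<le> C * norm h"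
      by (elim landau_o.bigE)
    have "\<forall>\<^sub>F h in at_right 0. 0 < h \<and> h < 1 / C"
      using \<open>C > 0\<close> by (auto simp: eventually_at_right_field intro: exI[of _ "1 / C"])
    with C have small: "\<forall>\<^sub>F h in at_right 0. \<bar>e h\<bar> \<le> 1"
    proof eventually_elim
      case (elim h)
      then have "C * norm h \<le> 1" using \<open>C > 0\<close> by (simp add: field_simps)
      with elim show ?case by simp
    qed
    have "(\<lambda>h. f (t h + z * h) (D 0 (t h + z * h)) (D 1 (t h + z * h)) - f (t h + z * h) (D 0 (t h + z * h)) (v h)
             - g (t h) * e h) \<in> O[at_right 0](\<lambda>h. (\<bar>z * h\<bar> + \<bar>e h\<bar>) * \<bar>e h\<bar>)"
    proof (rule bigoI)
      show "\<forall>\<^sub>F h in at_right 0. norm (f (t h + z * h) (D 0 (t h + z * h)) (D 1 (t h + z * h))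
             - f (t h + z * h) (D 0 (t h + z * h)) (v h) - g (t h) * e h)
           \<le> M * norm ((\<bar>z * h\<bar> + \<bar>e h\<bar>) * \<bar>e h\<bar>)"
        using t tz small
      proof eventually_elim
        case (elim h)
        then show ?case using gM(2)[of "t h" "t h + z * h" "v h"]
          by (simp add: e_def abs_mult mult.assoc)
      qed
    qed
    also have "(\<lambda>h. (\<bar>z * h\<bar> + \<bar>e h\<bar>) * \<bar>e h\<bar>) \<in> O[at_right 0](\<lambda>h. h * h ^ Suc n)"
    proof (rule landau_o.big.mult)
      have "(\<lambda>h. z * h) \<in> O[at_right 0](\<lambda>h. h)" by (rule bigo_cmult) simp
      then show "(\<lambda>h. \<bar>z * h\<bar> + \<bar>e h\<bar>) \<in> O[at_right 0](\<lambda>h. h)"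
        using e1 by (intro sum_in_bigo) (simp_all only: landau_o.big.abs_in_iff)
    qed (use e in simp)
    finally show "(\<lambda>h. f (t h + z * h) (D 0 (t h + z * h)) (D 1 (t h + z * h)) - f (t h + z * h) (D 0 (t h + z * h)) (v h)
             - g (t h) * (D 1 (t h + z * h) - v h)) \<in> O[at_right 0](\<lambda>h. h ^ Suc (Suc n))"
      by (simp add: e_def)
  qed
qed

end

section \<open>Error of one step\<close>

context smooth_ivp
begin

text \<open>Here the order of the derivative is gained: each stage contributes an error of size \<open>h^(s+1)\<close>,
but their sum weighted by \<open>d\<close> is one order smaller. Starting stages are accurate enough
by themselves. The errors of computed stages are, to leading order, multiples of the vector \<open>E\<close>
with a common factor, and \<open>d\<close> is orthogonal to \<open>E\<close>.\<close>

lemma weighted_rhs_error: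
  fixes c d :: "real^'s" and A B :: "real^'s^'s"
  defines "s \<equiv> CARD('s)"
  assumes N': "s + 3 \<le> N"
    and B: "\<And>i k. k < s \<Longrightarrow>
      (\<Sum>j\<in>UNIV. B $ i $ j * (c $ j - 1) ^ k) = (c $ i) ^ (k + 1) / (real k + 1)"
    and annihilate: "(\<Sum>i\<in>UNIV. d $ i * ((c $ i) ^ (s + 1) / (real s + 1)
            - (\<Sum>j\<in>UNIV. B $ i $ j * (c $ j - 1) ^ s))) = 0"
    and grid: "\<forall>\<^sub>F h in at_right 0. stage_grid_in J c h (t h)"
    and stages: "method_stages (s + 2) (s + 1) s c A B f J (D 0) (D 1) t u du Y dY"
    and du: "val_acc (s + 2) (D 1) t du"
    and Y: "stage_acc (s + 2) c (D 0) t Y" and dY: "stage_acc (s + 1) c (D 1) t dY"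
  shows "(\<lambda>h. \<Sum>i\<in>UNIV. d $ i * (D 2 (t h + c $ i * h) - stage_rhs f c h (t h) (Y h) (dY h) $ i))
           \<in> O[at_right 0](\<lambda>h. h ^ (s + 2))"
  using stages unfolding method_stages_def
proof (elim disjE exE conjE)
  assume "stage_acc (s + 2) c (D 0) t Y" "stage_acc (s + 2) c (D 1) t dY"
  then show ?thesis
    by (intro big_sum_in_bigo bigo_cmult stage_rhs_error[OF grid])
next
  fix X dX
  assume grid': "\<forall>\<^sub>F h in at_right 0. stage_grid_in J c h (t h - h)"
    and X: "stage_acc (s + 1 + 1) c (D 0) (\<lambda>h. t h - h) X"
    and dX: "stage_acc (s + 1) c (D 1) (\<lambda>h. t h - h) dX"
    and computed: "\<forall>\<^sub>F h in at_right 0.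
      Y h = new_stage c A h (u h) (du h) (stage_rhs f c h (t h - h) (X h) (dX h)) \<and>
      dY h = new_dstage B h (du h) (stage_rhs f c h (t h - h) (X h) (dX h))"
  define F where "F h = stage_rhs f c h (t h - h) (X h) (dX h)" for h
  \<comment> \<open>every leading stage error is this common factor times a constant of the method\<close>
  define K where "K h = h ^ (1 + s) * D (2 + s) (t h) / fact s" for h
  define E where "E i = (c $ i) ^ (s + 1) / (real s + 1)
            - (\<Sum>j\<in>UNIV. B $ i $ j * (c $ j - 1) ^ s)" for i
  define e where "e i h = D 1 (t h + c $ i * h) - dY h $ i" for i h
  have t: "\<forall>\<^sub>F h in at_right 0. t h \<in> J"
    and tc: "\<forall>\<^sub>F h in at_right 0. t h + c $ i * h \<in> J" for i
    using grid by (auto simp: stage_grid_in_def elim: eventually_mono)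
  \<comment> \<open>seen from the new grid point, the stages of the preceding step sit at the nodes shifted by 1\<close>
  have shift: "t h + (c - 1) $ j * h = t h - h + c $ j * h" for h j
    by (simp add: algebra_simps)
  have tc': "\<forall>\<^sub>F h in at_right 0. t h + (c - 1) $ j * h \<in> J" for j
    unfolding shift using grid' by (auto simp: stage_grid_in_def elim: eventually_mono)
  have F: "(\<lambda>h. D 2 (t h + (c - 1) $ j * h) - F h $ j) \<in> O[at_right 0](\<lambda>h. h ^ (s + 1))" for j
    unfolding shift F_def
    by (rule stage_rhs_error[OF grid' stage_acc_mono[OF X] dX]) simp
  have e_lead: "(\<lambda>h. e i h - K h * E i) \<in> O[at_right 0](\<lambda>h. h ^ (s + 2))" for i
  proof -
    define R where "R h = D 1 (t h + c $ i * h) - (\<Sum>k<1. D (1 + k) (t h) * (c $ i * h) ^ k / fact k)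
            - h ^ 1 * (\<Sum>j\<in>UNIV. (B $ i) $ j * D (1 + 1) (t h + (c - 1) $ j * h))
            - h ^ (1 + s) * D (1 + 1 + s) (t h) *
                ((c $ i) ^ (1 + s) / fact (1 + s) - (\<Sum>j\<in>UNIV. (B $ i) $ j * ((c - 1) $ j) ^ s) / fact s)" for h
    have R: "R \<in> O[at_right 0](\<lambda>h. h ^ (1 + Suc s))"
      unfolding R_def
      by (rule collocation_defect_leading[OF derivs convex_J _ t tc tc'])
         (use N' in simp, rule fact_moments(1), use B in simp)
    have defect: "\<forall>\<^sub>F h in at_right 0. e i h - K h * E i
       = R h + (D 1 (t h) - du h) + h ^ 1 * (\<Sum>j\<in>UNIV. B $ i $ j * (D 2 (t h + (c - 1) $ j * h) - F h $ j))"
      using computed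
    proof eventually_elim
      case (elim h)
      have "(c $ i) ^ (1 + s) / fact (1 + s) - (\<Sum>j\<in>UNIV. (B $ i) $ j * ((c - 1) $ j) ^ s) / fact s
          = E i / fact s"
        by (simp add: E_def diff_divide_distrib mult.commute add.commute)
      then have "h ^ (1 + s) * D (1 + 1 + s) (t h) *
                ((c $ i) ^ (1 + s) / fact (1 + s) - (\<Sum>j\<in>UNIV. (B $ i) $ j * ((c - 1) $ j) ^ s) / fact s)
           = K h * E i"
        by (simp add: K_def)
      moreover have "dY h $ i = du h + h * (\<Sum>j\<in>UNIV. B $ i $ j * F h $ j)"
        using elim by (simp add: F_def new_dstage_def matrix_vector_mult_def)
      ultimately show ?case
        by (simp add: R_def e_def right_diff_distrib sum_subtractf numeral_2_eq_2)
    qed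
    have "(\<lambda>h. R h + (D 1 (t h) - du h) + h ^ 1 * (\<Sum>j\<in>UNIV. B $ i $ j * (D 2 (t h + (c - 1) $ j * h) - F h $ j)))
        \<in> O[at_right 0](\<lambda>h. h ^ (s + 2))"
    proof (intro sum_in_bigo(1))
      show "(\<lambda>h. h ^ 1 * (\<Sum>j\<in>UNIV. B $ i $ j * (D 2 (t h + (c - 1) $ j * h) - F h $ j)))
          \<in> O[at_right 0](\<lambda>h. h ^ (s + 2))"
        using bigo_power_mult[of _ "s + 1" 1, OF big_sum_in_bigo[OF bigo_cmult[OF F]]] by simp
    qed (use R du in \<open>simp_all add: val_acc_def\<close>)
    then show ?thesis using landau_o.big.in_cong[OF defect] by blast
  qed
  obtain g M where g: "\<And>t. t \<in> J \<Longrightarrow> \<bar>g t\<bar> \<le> M"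
    and lin: "\<And>t z v n. \<lbrakk>\<forall>\<^sub>F h in at_right 0. t h \<in> J; \<forall>\<^sub>F h in at_right 0. t h + z * h \<in> J;
        (\<lambda>h. D 1 (t h + z * h) - v h) \<in> O[at_right 0](\<lambda>h. h ^ Suc n)\<rbrakk> \<Longrightarrow>
      (\<lambda>h. f (t h + z * h) (D 0 (t h + z * h)) (D 1 (t h + z * h)) - f (t h + z * h) (D 0 (t h + z * h)) (v h)
             - g (t h) * (D 1 (t h + z * h) - v h)) \<in> O[at_right 0](\<lambda>h. h ^ Suc (Suc n))"
    using rhs_linearisation_bigo by blast
  have g1: "(\<lambda>h. g (t h)) \<in> O[at_right 0](\<lambda>_. 1)"
    by (rule bigoI[of _ M], rule eventually_mono[OF t]) (use g in auto)
  define r where "r i h = D 2 (t h + c $ i * h) - stage_rhs f c h (t h) (Y h) (dY h) $ i" for i h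
  \<comment> \<open>the value argument is exchanged first, at the price of a Lipschitz term; the derivative argument is linearised\<close>
  have r: "(\<lambda>h. r i h - g (t h) * K h * E i) \<in> O[at_right 0](\<lambda>h. h ^ (s + 2))" for i
  proof -
    let ?\<tau> = "\<lambda>h. t h + c $ i * h"
    have "(\<lambda>h. f (?\<tau> h) (D 0 (?\<tau> h)) (dY h $ i) - f (?\<tau> h) (Y h $ i) (dY h $ i))
        \<in> O[at_right 0](\<lambda>h. h ^ (s + 2))"
      by (rule rhs_diff_bigo[OF tc]) (use Y in \<open>simp_all add: stage_acc_def\<close>)
    moreover have "(\<lambda>h. f (?\<tau> h) (D 0 (?\<tau> h)) (D 1 (?\<tau> h)) - f (?\<tau> h) (D 0 (?\<tau> h)) (dY h $ i)
             - g (t h) * e i h) \<in> O[at_right 0](\<lambda>h. h ^ (s + 2))"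
      using lin[OF t tc, of i "\<lambda>h. dY h $ i" s] dY by (simp add: stage_acc_def e_def)
    moreover have "(\<lambda>h. g (t h) * (e i h - K h * E i)) \<in> O[at_right 0](\<lambda>h. h ^ (s + 2))"
      using landau_o.big.mult[OF g1 e_lead[of i]] by simp
    ultimately have "(\<lambda>h. (f (?\<tau> h) (D 0 (?\<tau> h)) (dY h $ i) - f (?\<tau> h) (Y h $ i) (dY h $ i))
        + (f (?\<tau> h) (D 0 (?\<tau> h)) (D 1 (?\<tau> h)) - f (?\<tau> h) (D 0 (?\<tau> h)) (dY h $ i) - g (t h) * e i h)
        + g (t h) * (e i h - K h * E i)) \<in> O[at_right 0](\<lambda>h. h ^ (s + 2))"
      by (intro sum_in_bigo(1))
    then show ?thesis
      by (simp add: r_def ode stage_rhs_def algebra_simps)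
  qed
  have "(\<Sum>i\<in>UNIV. d $ i * r i h) = (\<Sum>i\<in>UNIV. d $ i * (r i h - g (t h) * K h * E i))" for h
  proof -
    have "(\<Sum>i\<in>UNIV. d $ i * (g (t h) * K h * E i)) = g (t h) * K h * (\<Sum>i\<in>UNIV. d $ i * E i)"
      by (simp add: sum_distrib_left mult_ac)
    also have "\<dots> = 0" using annihilate by (simp add: E_def)
    finally show ?thesis by (simp add: right_diff_distrib sum_subtractf)
  qed
  then show ?thesis
    unfolding r_def[symmetric] using big_sum_in_bigo[OF bigo_cmult[OF r]] by simp
qed

text \<open>An update inherits the error of the formula itself and the errors of the old value, of the old
derivative multiplied by \<open>h\<close>, and of the right-hand sides multiplied by \<open>h^2\<close>. The abscissa \<open>x\<close>
is \<open>1\<close> for the step itself and \<open>c\<^sub>i\<close> for a stage.\<close>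

lemma value_update_error:
  fixes w X :: "real^'s"
  assumes N': "n + 2 \<le> N" and ml: "m \<le> n + 2" "m \<le> l + 2"
    and a: "\<forall>\<^sub>F h in at_right 0. a h \<in> J" and b: "\<forall>\<^sub>F h in at_right 0. a h + x * h \<in> J"
    and X: "\<And>j. \<forall>\<^sub>F h in at_right 0. a h + X $ j * h \<in> J"
    and moments: "\<And>k. k < n \<Longrightarrow>
      (\<Sum>j\<in>UNIV. w $ j * (X $ j) ^ k) = x ^ (k + 2) / ((real k + 1) * (real k + 2))"
    and u: "val_acc m (D 0) a u" and du: "val_acc m (D 1) a du"
    and F: "\<And>j. (\<lambda>h. D 2 (a h + X $ j * h) - F h $ j) \<in> O[at_right 0](\<lambda>h. h ^ l)"
  shows "(\<lambda>h. D 0 (a h + x * h) - (u h + x * h * du h + h\<^sup>2 * (\<Sum>j\<in>UNIV. w $ j * F h $ j)))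
           \<in> O[at_right 0](\<lambda>h. h ^ m)"
proof -
  define R where "R h = D 0 (a h + x * h) - (\<Sum>k<2. D (0 + k) (a h) * (x * h) ^ k / fact k)
            - h ^ 2 * (\<Sum>j\<in>UNIV. w $ j * D (0 + 2) (a h + X $ j * h))" for h
  have "R \<in> O[at_right 0](\<lambda>h. h ^ (2 + n))"
    unfolding R_def
    by (rule collocation_defect_exact[OF derivs convex_J _ a b X])
       (use N' in simp, rule fact_moments(2)[OF moments])
  then have R: "R \<in> O[at_right 0](\<lambda>h. h ^ m)" by (rule bigo_power_mono) (use ml in simp)
  have "(\<lambda>h. h ^ 2 * (\<Sum>j\<in>UNIV. w $ j * (D 2 (a h + X $ j * h) - F h $ j)))
      \<in> O[at_right 0](\<lambda>h. h ^ (2 + l))"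
    by (intro bigo_power_mult big_sum_in_bigo bigo_cmult F)
  then have S: "(\<lambda>h. h ^ 2 * (\<Sum>j\<in>UNIV. w $ j * (D 2 (a h + X $ j * h) - F h $ j)))
      \<in> O[at_right 0](\<lambda>h. h ^ m)" by (rule bigo_power_mono) (use ml in simp)
  have "(\<lambda>h. h ^ 1 * (D 1 (a h) - du h)) \<in> O[at_right 0](\<lambda>h. h ^ (1 + m))"
    using du unfolding val_acc_def by (rule bigo_power_mult)
  then have "(\<lambda>h. x * (h ^ 1 * (D 1 (a h) - du h))) \<in> O[at_right 0](\<lambda>h. h ^ m)"
    by (intro bigo_cmult) (rule bigo_power_mono, assumption, simp)
  then have "(\<lambda>h. R h + (D 0 (a h) - u h) + x * (h ^ 1 * (D 1 (a h) - du h))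
      + h ^ 2 * (\<Sum>j\<in>UNIV. w $ j * (D 2 (a h + X $ j * h) - F h $ j)))
    \<in> O[at_right 0](\<lambda>h. h ^ m)"
    using R S u unfolding val_acc_def by (intro sum_in_bigo(1))
  then show ?thesis
    by (simp add: R_def numeral_2_eq_2 algebra_simps sum_subtractf)
qed

text \<open>Only the weighted sum of the errors of the right-hand sides is assumed small, so that
cancellation between the stages can be used.\<close>

lemma derivative_update_error:
  fixes w X :: "real^'s"
  assumes N': "n + 2 \<le> N" and ml: "m \<le> n + 1" "m \<le> l + 1"
    and a: "\<forall>\<^sub>F h in at_right 0. a h \<in> J" and b: "\<forall>\<^sub>F h in at_right 0. a h + x * h \<in> J"
    and X: "\<And>j. \<forall>\<^sub>F h in at_right 0. a h + X $ j * h \<in> J"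
    and moments: "\<And>k. k < n \<Longrightarrow>
      (\<Sum>j\<in>UNIV. w $ j * (X $ j) ^ k) = x ^ (k + 1) / (real k + 1)"
    and du: "val_acc m (D 1) a du"
    and F: "(\<lambda>h. \<Sum>j\<in>UNIV. w $ j * (D 2 (a h + X $ j * h) - F h $ j)) \<in> O[at_right 0](\<lambda>h. h ^ l)"
  shows "(\<lambda>h. D 1 (a h + x * h) - (du h + h * (\<Sum>j\<in>UNIV. w $ j * F h $ j)))
           \<in> O[at_right 0](\<lambda>h. h ^ m)"
proof -
  define R where "R h = D 1 (a h + x * h) - (\<Sum>k<1. D (1 + k) (a h) * (x * h) ^ k / fact k)
            - h ^ 1 * (\<Sum>j\<in>UNIV. w $ j * D (1 + 1) (a h + X $ j * h))" for h
  have "R \<in> O[at_right 0](\<lambda>h. h ^ (1 + n))"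
    unfolding R_def
    by (rule collocation_defect_exact[OF derivs convex_J _ a b X])
       (use N' in simp, rule fact_moments(1)[OF moments])
  then have R: "R \<in> O[at_right 0](\<lambda>h. h ^ m)" by (rule bigo_power_mono) (use ml in simp)
  have "(\<lambda>h. h ^ 1 * (\<Sum>j\<in>UNIV. w $ j * (D 2 (a h + X $ j * h) - F h $ j)))
      \<in> O[at_right 0](\<lambda>h. h ^ (1 + l))"
    by (rule bigo_power_mult[OF F])
  then have S: "(\<lambda>h. h ^ 1 * (\<Sum>j\<in>UNIV. w $ j * (D 2 (a h + X $ j * h) - F h $ j)))
      \<in> O[at_right 0](\<lambda>h. h ^ m)" by (rule bigo_power_mono) (use ml in simp)
  then have "(\<lambda>h. R h + (D 1 (a h) - du h)
      + h ^ 1 * (\<Sum>j\<in>UNIV. w $ j * (D 2 (a h + X $ j * h) - F h $ j)))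
    \<in> O[at_right 0](\<lambda>h. h ^ m)"
    using R du unfolding val_acc_def by (intro sum_in_bigo(1))
  then show ?thesis
    by (simp add: R_def numeral_2_eq_2 algebra_simps sum_subtractf)
qed

end

theorem theorem4p3:
  fixes c b d :: "real^'s" and A B :: "real^'s^'s"
  assumes distinct: "inj (\<lambda>i. c $ i)"
    and coeffs: "collocation_coeffs c b d A B"
    and double_int:
      "integral {0..1} (\<lambda>t. integral {0..1 + t} (\<lambda>\<xi>. \<Prod>i\<in>UNIV. (\<xi> - c $ i))) = 0"
    and orth:
      "\<forall>k\<in>{0, 1::nat}. integral {0..1} (\<lambda>\<xi>. \<xi> ^ k * (\<Prod>i\<in>UNIV. (\<xi> - c $ i))) = 0"
  shows "has_step_order c b d A B (CARD('s) + 2)"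
proof -
  define s where "s = CARD('s)"
  have b: "(\<Sum>i\<in>UNIV. b $ i * (c $ i) ^ k) = 1 ^ (k + 2) / ((real k + 1) * (real k + 2))"
    if "k < s + 1" for k
    using value_weights_exact[OF coeffs orth, of "monom 1 k"] that
    by (simp add: s_def degree_monom_eq poly_monom antideriv_monom add.commute)
  have d: "(\<Sum>i\<in>UNIV. d $ i * (c $ i) ^ k) = 1 ^ (k + 1) / (real k + 1)"
    if "k < s + 2" for k
    using derivative_weights_exact[OF coeffs orth, of "monom 1 k"] that
    by (simp add: s_def degree_monom_eq poly_monom antideriv_monom add.commute)
  have AB: "(\<Sum>j\<in>UNIV. (A $ i) $ j * ((c - 1) $ j) ^ k) = (c $ i) ^ (k + 2) / ((real k + 1) * (real k + 2))"
    "(\<Sum>j\<in>UNIV. (B $ i) $ j * ((c - 1) $ j) ^ k) = (c $ i) ^ (k + 1) / (real k + 1)"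
    if "k < s" for i k
    using collocation_moments(3,4)[OF coeffs, of k i] that by (simp_all add: s_def)
  have "has_orders c b d A B (s + 2) (s + 2) (s + 1) s"
    unfolding has_orders_def Let_def
  \<comment> \<open>the error of the quadrature for the derivative involves s + 3 derivatives beyond the first\<close>
  proof (intro exI[of _ "s + 4"] allI impI)
    fix f t0 T y0 dy0 y dy t u du and Y dY :: "real \<Rightarrow> real^'s"
    assume sol: "smooth_ivp_solution (s + 4) f t0 T y0 dy0 y dy"
      and grid: "\<forall>\<^sub>F h in at_right 0. stage_grid_in {t0..t0+T} c h (t h)"
      and grid1: "\<forall>\<^sub>F h in at_right 0. stage_grid_in {t0..t0+T} c h (t h + h)"
      and stages: "method_stages (min (s + 2) (s + 2)) (s + 1) s c A B f {t0..t0+T} y dy t u du Y dY"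
      and u: "val_acc (s + 2 + 1) y t u" and du: "val_acc (s + 2 + 1) dy t du"
      and Y: "stage_acc (s + 1 + 1) c y t Y" and dY: "stage_acc (s + 1) c dy t dY"
    obtain D where D: "smooth_ivp f {t0..t0+T} D (s + 4)" "D 0 = y" "D 1 = dy"
      using smooth_ivp_solution_imp_smooth_ivp[OF sol] by auto
    interpret smooth_ivp f "{t0..t0+T}" D "s + 4" by (rule D(1))
    have u': "val_acc (s + 3) (D 0) t u" and du': "val_acc (s + 3) (D 1) t du"
      using val_acc_mono[OF u, of "s + 3"] val_acc_mono[OF du, of "s + 3"] by (simp_all only: D)
    define F where "F h = stage_rhs f c h (t h) (Y h) (dY h)" for h
    define u1 where "u1 h = new_val b h (u h) (du h) (F h)" for h
    define du1 where "du1 h = new_deriv d h (du h) (F h)" for h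
    have t: "\<forall>\<^sub>F h in at_right 0. t h \<in> {t0..t0+T}"
      and tc: "\<forall>\<^sub>F h in at_right 0. t h + c $ i * h \<in> {t0..t0+T}" for i
      using grid by (auto simp: stage_grid_in_def elim: eventually_mono)
    have t1: "\<forall>\<^sub>F h in at_right 0. t h + h \<in> {t0..t0+T}"
      and t1c: "\<forall>\<^sub>F h in at_right 0. t h + h + c $ i * h \<in> {t0..t0+T}" for i
      using grid1 by (auto simp: stage_grid_in_def elim: eventually_mono)
    have shift: "t h + h + (c - 1) $ j * h = t h + c $ j * h" for h j
      by (simp add: algebra_simps)
    have F: "(\<lambda>h. D 2 (t h + c $ j * h) - F h $ j) \<in> O[at_right 0](\<lambda>h. h ^ (s + 1))" for j
      unfolding F_def using Y dY D
      by (intro stage_rhs_error[OF grid]) (auto intro: stage_acc_mono)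
    have dF: "(\<lambda>h. \<Sum>j\<in>UNIV. d $ j * (D 2 (t h + c $ j * h) - F h $ j)) \<in> O[at_right 0](\<lambda>h. h ^ (s + 2))"
      unfolding F_def s_def
    proof (rule weighted_rhs_error[where A = A and B = B and u = u and du = du])
      show "(\<Sum>j\<in>UNIV. B $ i $ j * (c $ j - 1) ^ k) = (c $ i) ^ (k + 1) / (real k + 1)"
        if "k < CARD('s)" for i k
        using collocation_moments(4)[OF coeffs that] .
      show "val_acc (CARD('s) + 2) (D 1) t du"
        using val_acc_mono[OF du'] by (simp add: s_def)
    qed (use derivative_weights_annihilate_stage_defect[OF coeffs double_int orth] grid stages Y dY D in \<open>simp_all add: s_def\<close>)
    have u1: "val_acc (s + 3) y (\<lambda>h. t h + h) u1"
      using value_update_error[of "s + 1" "s + 3" "s + 1" t 1 c b u du F, OF _ _ _ t _ tc b u' du' F] t1 D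
      by (simp add: val_acc_def u1_def[abs_def] new_val_def inner_vec_def)
    have du1: "val_acc (s + 3) dy (\<lambda>h. t h + h) du1"
      using derivative_update_error[of "s + 2" "s + 3" "s + 2" t 1 c d du F, OF _ _ _ t _ tc d du' dF] t1 D
      by (simp add: val_acc_def du1_def[abs_def] new_deriv_def inner_vec_def)
    have Y1: "stage_acc (s + 2) c y (\<lambda>h. t h + h) (\<lambda>h. new_stage c A h (u1 h) (du1 h) (F h))"
      unfolding stage_acc_def
    proof
      fix i
      have "(\<lambda>h. D 0 (t h + h + c $ i * h)
            - (u1 h + c $ i * h * du1 h + h\<^sup>2 * (\<Sum>j\<in>UNIV. A $ i $ j * F h $ j)))
          \<in> O[at_right 0](\<lambda>h. h ^ (s + 2))"
      proof (rule value_update_error[where n = s and l = "s + 1" and X = "c - 1"])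
        show "\<forall>\<^sub>F h in at_right 0. t h + h + (c - 1) $ j * h \<in> {t0..t0+T}" for j
          unfolding shift by (rule tc)
        show "(\<lambda>h. D 2 (t h + h + (c - 1) $ j * h) - F h $ j) \<in> O[at_right 0](\<lambda>h. h ^ (s + 1))" for j
          unfolding shift by (rule F)
        show "val_acc (s + 2) (D 0) (\<lambda>h. t h + h) u1" "val_acc (s + 2) (D 1) (\<lambda>h. t h + h) du1"
          unfolding D by (rule val_acc_mono[OF u1], simp) (rule val_acc_mono[OF du1], simp)
      qed (rule t1 t1c AB(1) | assumption | simp)+
      then show "(\<lambda>h. y (t h + h + c $ i * h) - new_stage c A h (u1 h) (du1 h) (F h) $ i)
          \<in> O[at_right 0](\<lambda>h. h ^ (s + 2))"
        by (simp add: D new_stage_def matrix_vector_mult_def mult_ac)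
    qed
    have dY1: "stage_acc (s + 1) c dy (\<lambda>h. t h + h) (\<lambda>h. new_dstage B h (du1 h) (F h))"
      unfolding stage_acc_def
    proof
      fix i
      have "(\<lambda>h. D 1 (t h + h + c $ i * h) - (du1 h + h * (\<Sum>j\<in>UNIV. B $ i $ j * F h $ j)))
          \<in> O[at_right 0](\<lambda>h. h ^ (s + 1))"
      proof (rule derivative_update_error[where n = s and l = "s + 1" and X = "c - 1"])
        show "(\<lambda>h. \<Sum>j\<in>UNIV. B $ i $ j * (D 2 (t h + h + (c - 1) $ j * h) - F h $ j))
            \<in> O[at_right 0](\<lambda>h. h ^ (s + 1))"
          unfolding shift by (intro big_sum_in_bigo bigo_cmult F)
        show "\<forall>\<^sub>F h in at_right 0. t h + h + (c - 1) $ j * h \<in> {t0..t0+T}" for j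
          unfolding shift by (rule tc)
        show "val_acc (s + 1) (D 1) (\<lambda>h. t h + h) du1"
          unfolding D by (rule val_acc_mono[OF du1]) simp
      qed (rule t1 t1c AB(2) | assumption | simp)+
      then show "(\<lambda>h. dy (t h + h + c $ i * h) - new_dstage B h (du1 h) (F h) $ i)
          \<in> O[at_right 0](\<lambda>h. h ^ (s + 1))"
        using D(3) by (simp add: new_dstage_def matrix_vector_mult_def)
    qed
    show "val_acc (s + 2 + 1) y (\<lambda>h. t h + h)
            (\<lambda>h. new_val b h (u h) (du h) (stage_rhs f c h (t h) (Y h) (dY h))) \<and>
          val_acc (s + 2 + 1) dy (\<lambda>h. t h + h)
            (\<lambda>h. new_deriv d h (du h) (stage_rhs f c h (t h) (Y h) (dY h))) \<and>
          stage_acc (s + 1 + 1) c y (\<lambda>h. t h + h)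
            (\<lambda>h. new_stage c A h (new_val b h (u h) (du h) (stage_rhs f c h (t h) (Y h) (dY h)))
                (new_deriv d h (du h) (stage_rhs f c h (t h) (Y h) (dY h)))
                (stage_rhs f c h (t h) (Y h) (dY h))) \<and>
          stage_acc (s + 1) c dy (\<lambda>h. t h + h)
            (\<lambda>h. new_dstage B h (new_deriv d h (du h) (stage_rhs f c h (t h) (Y h) (dY h)))
                (stage_rhs f c h (t h) (Y h) (dY h)))"
      unfolding F_def[symmetric] u1_def[symmetric] du1_def[symmetric]
      using u1 du1 Y1 dY1 by (simp add: eval_nat_numeral)
  qed
  then show ?thesis
    unfolding has_step_order_def s_def by (intro exI conjI) (assumption, simp)
qed

end
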